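(* Let $t>0$. Let $\mathrm{C}$ and $\mathrm{D}$ be generators of $C_0$-semigroups $\exp(s\mathrm{C})$ and $\exp(s\mathrm{D})$ in a Banach space $\mathbf{X}$. Assume that there exists a set $\mathbf{B}\subset\mathcal{D}\big((\exp(s\mathrm{C})^* )'_{s=0}\big)\cap\mathcal{D}\big((\exp(s\mathrm{D})^* )'_{s=0}\big)$ such that the following conditions are satisfied: (i) $\mathcal{D}(\mathrm{C})\cap\mathcal{D}(\mathrm{D})$ is dense in $\mathbf{X}$. (ii) $\mathbf{B}$ is weak-$*$ dense in $\mathbf{X}^*$. (iii) There exist $a\in\mathbb{R}$ and $M\ge 1$ such that $\|\{\exp(\frac{s}{n}\mathrm{C})\exp(\frac{s}{n}\mathrm{D})\}^m\|\le M\exp(as\frac{m}{n})$ for all $n,m\in\mathbb{N}$, $s>0$. (iv) For each $x\in(\exp(s\mathrm{C})^* )'_{s=0}(\mathbf{B})$, the function $s\mapsto(\exp(s\mathrm{D}))^*x$, $s\ge 0$, is continuous at $s=0$ (in the norm of $\mathbf{X}^*$). Then the sum $\mathrm{C}+\mathrm{D}$ is a closable operator and its closure is a generator of a $C_0$-semigroup if and only if there exists a dense linear subspace $\mathbf{A}\subseteq\mathcal{D}(\mathrm{C})\cap\mathcal{D}(\mathrm{D})$ (dense in $\mathbf{X}$) such that for all $f\in\mathbf{A}$, $s\ge 0$ there exists a sequence $\{f_n^s\}_{n=1}^\infty$, $f_n^s\in\mathcal{D}(\mathrm{C})\cap\mathcal{D}(\mathrm{D})$, satisfying the following conditions: (a)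 $\lim_{n\to\infty}\|(\exp(\frac{t}{n}\mathrm{C})\exp(\frac{t}{n}\mathrm{D}))^{[ns]}f-f_n^s\|=0$; (b) every subsequence of $\{f_n^s\}_{n=1}^\infty$ has a weakly convergent subsequence; (c) every subsequence of $\{(\mathrm{C}+\mathrm{D})f_n^s\}_{n=1}^\infty$ has a weakly convergent subsequence. Furthermore, if conditions (a)–(c) are satisfied (for such $\mathbf{A}$ and sequences), then $$\exp(s(\overline{\mathrm{C}+\mathrm{D}}))f=\lim_{n\to\infty}\{\exp(\tfrac{s}{n}\mathrm{C})\exp(\tfrac{s}{n}\mathrm{D})\}^n f,\qquad s\ge 0,$$ for all $f\in\mathbf{X}$.
   Context: The sum $\mathrm{C}+\mathrm{D}$ has domain $\mathcal{D}(\mathrm{C})\cap\mathcal{D}(\mathrm{D})$. For a $C_0$-semigroup $\mathrm{T}$ on $\mathbf{X}$, $(\mathrm{T}(s)^* )'_{s=0}$ denotes the strong derivative at $0$ of the function $s\mapsto\mathrm{T}(s)^*\in\mathcal{L}(\mathbf{X}^* )$, i.e. the linear operator $\phi\mapsto\lim_{h\to0}h^{-1}(\mathrm{T}(h)^*\phi-\phi)$ (limit in the norm of $\mathbf{X}^*$, $h>0$), with domain the set of all $\phi\in\mathbf{X}^*$ for which the limit exists. $(\exp(s\mathrm{C})^* )'_{s=0}(\mathbf{B})$ is the image of $\mathbf{B}$ under this operator. $[x]$ is the integer part of $x$. *)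

theory Defs
  imports "HOL-Analysis.Analysis"
begin

text \<open>
  Unbounded operators in a space are represented by their graphs, so the domain of an operator
  is the \<^const>\<open>Domain\<close> of its graph, and operator closure is topological closure in the
  product space. The dual of \<open>'a\<close> is the normed space \<open>'a \<Rightarrow>\<^sub>L real\<close>.
\<close>

text \<open>Only the values \<open>T s\<close> with \<open>s \<ge> 0\<close> are relevant.\<close>
definition c0_semigroup :: "(real \<Rightarrow> 'a::real_normed_vector \<Rightarrow>\<^sub>L 'a) \<Rightarrow> bool" where
  "c0_semigroup T \<longleftrightarrow>
     T 0 = id_blinfun \<and>
     (\<forall>s\<ge>0. \<forall>r\<ge>0. T (s + r) = T s o\<^sub>L T r) \<and>
     (\<forall>x. ((\<lambda>s. T s x) \<longlongrightarrow> x) (at_right 0))"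

definition strong_deriv0 :: "(real \<Rightarrow> 'a::real_normed_vector \<Rightarrow>\<^sub>L 'a) \<Rightarrow> ('a \<times> 'a) set" where
  "strong_deriv0 T = {(x, y). ((\<lambda>h. (T h x - x) /\<^sub>R h) \<longlongrightarrow> y) (at_right 0)}"

definition generates :: "('a \<times> 'a) set \<Rightarrow> (real \<Rightarrow> 'a::real_normed_vector \<Rightarrow>\<^sub>L 'a) \<Rightarrow> bool" where
  "generates C T \<longleftrightarrow> c0_semigroup T \<and> C = strong_deriv0 T"

definition op_sum :: "('a \<times> 'a) set \<Rightarrow> ('a \<times> 'a) set \<Rightarrow> ('a \<times> 'a::plus) set" where
  "op_sum C D = {(x, y + z) | x y z. (x, y) \<in> C \<and> (x, z) \<in> D}"

definition closable :: "('a \<times> 'a::topological_space) set \<Rightarrow> bool" where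
  "closable G \<longleftrightarrow> single_valued (closure G)"

lift_definition adjoint_op ::
    "('a::real_normed_vector \<Rightarrow>\<^sub>L 'b::real_normed_vector) \<Rightarrow> ('b \<Rightarrow>\<^sub>L real) \<Rightarrow>\<^sub>L ('a \<Rightarrow>\<^sub>L real)"
  is "\<lambda>A \<phi>. \<phi> o\<^sub>L A"
  by (rule bounded_bilinear.bounded_linear_left[OF bounded_bilinear_blinfun_compose])

text \<open>For scalar-valued functionals the strong operator topology is the topology of pointwise
  convergence, that is, the weak-* topology of the dual.\<close>
abbreviation weak_star_topology :: "('a::real_normed_vector \<Rightarrow>\<^sub>L real) topology" where
  "weak_star_topology \<equiv> strong_operator_topology"

definition weakly_convergent :: "(nat \<Rightarrow> 'a::real_normed_vector) \<Rightarrow> bool" where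
  "weakly_convergent f \<longleftrightarrow>
     (\<exists>l. \<forall>\<phi>::'a \<Rightarrow>\<^sub>L real. (\<lambda>n. \<phi> (f n)) \<longlonglongrightarrow> \<phi> l)"

definition weakly_subseq_compact :: "(nat \<Rightarrow> 'a::real_normed_vector) \<Rightarrow> bool" where
  "weakly_subseq_compact f \<longleftrightarrow>
     (\<forall>r. strict_mono r \<longrightarrow>
        (\<exists>q::nat \<Rightarrow> nat. strict_mono q \<and> weakly_convergent (f \<circ> r \<circ> q)))"

text \<open>
  Here \<open>g n\<close> is the approximant \<open>f\<^sub>n\<^sup>s\<close> and \<open>h n\<close> is the value of the sum of the generators at
  \<open>g n\<close>. The sequences are indexed from \<open>0\<close> instead of \<open>1\<close>; the additional term affects none
  of the conditions (it may be taken to be \<open>0\<close>).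
\<close>
definition approximable ::
    "real \<Rightarrow> (real \<Rightarrow> 'a::real_normed_vector \<Rightarrow>\<^sub>L 'a) \<Rightarrow> (real \<Rightarrow> 'a \<Rightarrow>\<^sub>L 'a) \<Rightarrow>
      ('a \<times> 'a) set \<Rightarrow> ('a \<times> 'a) set \<Rightarrow> 'a \<Rightarrow> real \<Rightarrow> bool" where
  "approximable t S T C D f s \<longleftrightarrow>
     (\<exists>g h. (\<forall>n. (g n, h n) \<in> op_sum C D) \<and>
        (\<lambda>n. norm ((blinfun_apply (S (t / real n) o\<^sub>L T (t / real n)) ^^ nat \<lfloor>real n * s\<rfloor>) f - g n))
          \<longlonglongrightarrow> 0 \<and>
        weakly_subseq_compact g \<and>
        weakly_subseq_compact h)"

definition approximation_subspace ::
    "real \<Rightarrow> (real \<Rightarrow> 'a::real_normed_vector \<Rightarrow>\<^sub>L 'a) \<Rightarrow> (real \<Rightarrow> 'a \<Rightarrow>\<^sub>L 'a) \<Rightarrow>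
      ('a \<times> 'a) set \<Rightarrow> ('a \<times> 'a) set \<Rightarrow> 'a set \<Rightarrow> bool" where
  "approximation_subspace t S T C D A \<longleftrightarrow>
     subspace A \<and> A \<subseteq> Domain C \<inter> Domain D \<and> closure A = UNIV \<and>
     (\<forall>f\<in>A. \<forall>s\<ge>0. approximable t S T C D f s)"

end

theory Submission
  imports Defs "HOL-Library.Diagonal_Subsequence"
begin

text \<open>
  Write \<open>V \<tau> = exp (\<tau> C) exp (\<tau> D)\<close> and \<open>W \<tau> r = V \<tau> ^ \<lfloor>r / \<tau>\<rfloor>\<close>; all limits are taken for \<open>\<tau> \<rightarrow> 0+\<close>.
  Stability gives equicontinuity of \<open>W \<tau> r x\<close> in \<open>r\<close>, hence a first-order expansion of \<open>W \<tau> h x\<close>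
  that holds on the closure of \<open>C + D\<close>. It yields closability and the convergence of \<open>W \<tau> r f\<close> to
  \<open>u r\<close> for every classical solution \<open>u\<close> of the Cauchy problem for the closure with \<open>u 0 = f\<close>
  (Chernoff's formula). If the closure generates a semigroup, the required approximants are graph
  approximations of the orbits. Conversely, a diagonal subsequence makes \<open>W \<tau> r f\<close> converge weakly for
  all \<open>r\<close> and \<open>f \<in> A\<close>; by Mazur's theorem and the functionals in \<open>B\<close> the weak limit is a classical
  solution. The convergence is therefore strong, and its limit is a semigroup generated by the closure.
\<close>

subsection \<open>The Hahn--Banach theorem and weak limits\<close>

text \<open>Neither resolvents nor vector-valued integrals occur. Derivatives are increment
  estimates with error \<open>e * h\<close>, uniform over bounded times; such errors add up over
  subdivisions, and they pass to weak limits because the norm is weakly lower semicontinuous. The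
  obstacle in the converse is that two vectors compete for the value of the closure at the weak
  limit \<open>u s\<close>. With \<open>(f, y)\<close> in the graph, the derivative of
  \<open>u\<close> is the weak limit \<open>w s\<close> of \<open>W \<tau> s y\<close>; condition
  (c) yields another weak limit \<open>l'\<close>, and only \<open>(u s, l')\<close> is known to lie
  in the closed graph. They cannot be compared directly, since \<open>C + D\<close> need not commute
  with the products. But \<open>V \<tau>\<close> commutes with its own powers, so under a functional
  from \<open>B\<close> its difference quotient can be moved onto the functional. There it converges
  in norm by (iv), and norm convergence is what is required, as \<open>W \<tau> s f\<close>
  converges only weakly.\<close>

definition sublinear :: "('a::real_vector \<Rightarrow> real) \<Rightarrow> bool" where
  "sublinear p \<longleftrightarrow>
     (\<forall>x y. p (x + y) \<le> p x + p y) \<and> (\<forall>c>0. \<forall>x. p (c *\<^sub>R x) \<le> c * p x)"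

lemma sublinear_add: "sublinear p \<Longrightarrow> p (x + y) \<le> p x + p y"
  by (simp add: sublinear_def)

text \<open>Homogeneity is only an inequality for \<open>c > 0\<close>, the form that survives
  infima. The scalars 2 and 1/2 exclude a negative and a positive value at the origin.\<close>

lemma sublinear_zero:
  assumes "sublinear p"
  shows "p 0 = 0"
proof -
  have "p 0 \<le> 2 * p 0" "p 0 \<le> (1/2) * p 0"
    using assms unfolding sublinear_def by (metis scaleR_zero_right zero_less_numeral,
      metis scaleR_zero_right half_gt_zero_iff zero_less_one)
  then show ?thesis by simp
qed

lemma sublinear_scaleR:
  assumes "sublinear p" "c \<ge> 0"
  shows "p (c *\<^sub>R x) = c * p x"
proof (cases "c = 0")
  case True
  then show ?thesis using sublinear_zero[OF assms(1)] by simp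
next
  case False
  with assms have c: "c > 0" by simp
  have "p ((1/c) *\<^sub>R (c *\<^sub>R x)) \<le> (1/c) * p (c *\<^sub>R x)"
    using assms(1) c unfolding sublinear_def by (meson divide_pos_pos zero_less_one)
  then have "c * p x \<le> p (c *\<^sub>R x)"
    using c by (simp add: field_simps)
  then show ?thesis using assms(1) c unfolding sublinear_def by (meson antisym)
qed

lemma sublinear_minus_le:
  assumes "sublinear p"
  shows "- p (- x) \<le> p x"
  using sublinear_add[OF assms, of x "- x"] sublinear_zero[OF assms] by simp

text \<open>The infimum over \<open>t\<close> is finite because subadditivity bounds every term
  below by \<open>- p (- x)\<close>. If the shift changes nothing, \<open>p\<close> is additive in
  direction \<open>v\<close>; and \<open>t = 1\<close> at the point \<open>- v\<close> bounds the
  new value there by \<open>- p v\<close>.\<close>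

lemma sublinear_shift:
  fixes v :: "'a::real_vector"
  assumes "sublinear p"
  obtains q where "sublinear q" "\<And>x. q x \<le> p x"
    "\<And>x t. t \<ge> 0 \<Longrightarrow> q x \<le> p (x + t *\<^sub>R v) - t * p v"
proof
  define f where "f x t = p (x + t *\<^sub>R v) - t * p v" for x t
  define q where "q x = (INF t\<in>{0..}. f x t)" for x
  have lower: "- p (- x) \<le> f x t" if "t \<ge> 0" for x t
    using sublinear_add[OF assms, of "x + t *\<^sub>R v" "- x"] sublinear_scaleR[OF assms that, of v]
    by (simp add: f_def)
  have le: "q x \<le> f x t" if "t \<ge> 0" for x t
    unfolding q_def using that lower by (intro cINF_lower bdd_belowI2) auto
  have ge: "c \<le> q x" if "\<And>t. t \<ge> 0 \<Longrightarrow> c \<le> f x t" for c x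
    unfolding q_def using that by (intro cINF_greatest) auto
  show "q x \<le> p (x + t *\<^sub>R v) - t * p v" if "t \<ge> 0" for x t
    using le[OF that] by (simp add: f_def)
  show "q x \<le> p x" for x
    using le[of 0 x] by (simp add: f_def)
  have "q (x + y) \<le> q x + q y" for x y
  proof -
    have "q (x + y) - f y s \<le> q x" if s: "s \<ge> 0" for s
    proof (rule ge)
      fix t :: real assume t: "t \<ge> 0"
      have "q (x + y) \<le> f (x + y) (t + s)" using s t by (intro le) simp
      also have "\<dots> = p ((x + t *\<^sub>R v) + (y + s *\<^sub>R v)) - (t + s) * p v"
        by (simp add: f_def algebra_simps)
      also have "\<dots> \<le> f x t + f y s"
        using sublinear_add[OF assms, of "x + t *\<^sub>R v" "y + s *\<^sub>R v"]
        by (simp add: f_def algebra_simps)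
      finally show "q (x + y) - f y s \<le> f x t" by simp
    qed
    then have "q (x + y) - q x \<le> f y s" if "s \<ge> 0" for s
      using that by (simp add: algebra_simps)
    from ge[OF this] show ?thesis by simp
  qed
  moreover have "q (c *\<^sub>R x) \<le> c * q x" if c: "c > 0" for c x
  proof -
    have "q (c *\<^sub>R x) / c \<le> f x t" if t: "t \<ge> 0" for t
    proof -
      have "q (c *\<^sub>R x) \<le> f (c *\<^sub>R x) (c * t)" using c t by (intro le) simp
      also have "\<dots> = p (c *\<^sub>R (x + t *\<^sub>R v)) - c * t * p v"
        by (simp add: f_def algebra_simps)
      also have "\<dots> = c * f x t"
        using c sublinear_scaleR[OF assms, of c "x + t *\<^sub>R v"]
        by (simp add: f_def algebra_simps)
      finally show ?thesis using c by (simp add: field_simps)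
    qed
    from ge[OF this] show ?thesis using c by (simp add: field_simps)
  qed
  ultimately show "sublinear q" by (simp add: sublinear_def)
qed

lemma exists_minimal_sublinear:
  assumes "sublinear p"
  obtains m where "sublinear m" "m \<le> p" "\<And>q. sublinear q \<Longrightarrow> q \<le> m \<Longrightarrow> q = m"
proof -
  define A where "A = {q. sublinear q \<and> q \<le> p}"
  \<comment> \<open>The order is reversed, so that the maximal element given by Zorn's lemma is a
    minimal functional.\<close>
  define P where "P = (\<lambda>q r :: 'a \<Rightarrow> real. r \<le> q)"
  have "\<exists>m\<in>A. \<forall>q\<in>A. P m q \<longrightarrow> q = m"
  proof (rule predicate_Zorn)
    show "partial_order_on A (relation_of P A)"
      unfolding P_def by (rule partial_order_on_relation_ofI) auto
  next
    fix C assume C: "C \<in> Chains (relation_of P A)"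
    show "\<exists>u\<in>A. \<forall>a\<in>C. P a u"
    proof (cases "C = {}")
      case True
      then show ?thesis using assms by (auto simp: A_def)
    next
      case False
      have CA: "C \<subseteq> A" and chain: "\<And>q r. q \<in> C \<Longrightarrow> r \<in> C \<Longrightarrow> q \<le> r \<or> r \<le> q"
        using C by (auto simp: Chains_def relation_of_def P_def)
      define u where "u x = (INF q\<in>C. q x)" for x
      have lower: "- p (- x) \<le> q x" if "q \<in> C" for q x
      proof -
        have "q \<in> A" using that CA by auto
        then have "sublinear q" "q (- x) \<le> p (- x)" by (auto simp: A_def le_fun_def)
        with sublinear_minus_le[of q x] show ?thesis by simp
      qed
      have le: "u x \<le> q x" if "q \<in> C" for q x
        unfolding u_def using that lower by (intro cINF_lower bdd_belowI2) auto
      have ge: "c \<le> u x" if "\<And>q. q \<in> C \<Longrightarrow> c \<le> q x" for c x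
        unfolding u_def using that False by (intro cINF_greatest) auto
      have sub: "sublinear q" if "q \<in> C" for q using that CA by (auto simp: A_def)
      have "u (x + y) \<le> u x + u y" for x y
      proof -
        have "u (x + y) - r y \<le> u x" if r: "r \<in> C" for r
        proof (rule ge)
          fix q assume q: "q \<in> C"
          \<comment> \<open>The infima at \<open>x\<close> and at \<open>y\<close> are taken
            independently; in a chain one member lies below both \<open>q\<close> and
            \<open>r\<close>, and its subadditivity links them.\<close>
          obtain z where z: "z \<in> C" "z \<le> q" "z \<le> r" using chain[OF q r] q r by auto
          have "u (x + y) \<le> z x + z y"
            using le[OF z(1), of "x + y"] sublinear_add[OF sub[OF z(1)], of x y] by simp
          also have "\<dots> \<le> q x + r y" using z by (intro add_mono) (auto simp: le_fun_def)
          finally show "u (x + y) - r y \<le> q x" by simp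
        qed
        then have "u (x + y) - u x \<le> r y" if "r \<in> C" for r
          using that by (simp add: algebra_simps)
        then have "u (x + y) - u x \<le> u y" by (rule ge)
        then show ?thesis by simp
      qed
      moreover have "u (c *\<^sub>R x) \<le> c * u x" if c: "c > 0" for c x
      proof -
        have "u (c *\<^sub>R x) / c \<le> q x" if q: "q \<in> C" for q
          using le[OF q, of "c *\<^sub>R x"] sublinear_scaleR[OF sub[OF q], of c x] c
          by (simp add: field_simps)
        then have "u (c *\<^sub>R x) / c \<le> u x" by (rule ge)
        then show ?thesis using c by (simp add: field_simps)
      qed
      moreover have "u \<le> p"
      proof -
        obtain q where q: "q \<in> C" using False by auto
        then have "q \<le> p" using CA by (auto simp: A_def)
        with le[OF q] show ?thesis by (meson le_fun_def order_trans)
      qed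
      ultimately have "u \<in> A" by (simp add: A_def sublinear_def)
      moreover have "\<forall>a\<in>C. P a u" using le by (auto simp: P_def le_fun_def)
      ultimately show ?thesis by blast
    qed
  qed
  then obtain m where m: "m \<in> A" "\<And>q. q \<in> A \<Longrightarrow> q \<le> m \<Longrightarrow> q = m"
    by (auto simp: P_def)
  show ?thesis
  proof
    show "sublinear m" "m \<le> p" using m(1) by (auto simp: A_def)
    then show "q = m" if "sublinear q" "q \<le> m" for q
      using m(2)[of q] that by (auto simp: A_def)
  qed
qed

text \<open>
  A minimal sublinear functional is linear, because shifting it in any direction cannot make it
  smaller; prescribing the value at one point is achieved by shifting before minimizing.
\<close>
theorem Hahn_Banach_sublinear:
  fixes x0 :: "'a::real_vector"
  assumes "sublinear p"
  obtains \<phi> where "linear \<phi>" "\<And>x. \<phi> x \<le> p x" "\<phi> x0 = p x0"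
proof -
  obtain p' where p': "sublinear p'" "\<And>x. p' x \<le> p x"
      "\<And>x t. t \<ge> 0 \<Longrightarrow> p' x \<le> p (x + t *\<^sub>R x0) - t * p x0"
    using sublinear_shift[OF assms, where v = x0] by metis
  obtain m where m: "sublinear m" "m \<le> p'" and min: "\<And>q. sublinear q \<Longrightarrow> q \<le> m \<Longrightarrow> q = m"
    using exists_minimal_sublinear[OF p'(1)] by metis
  have add: "m (x + y) = m x + m y" for x y
  proof -
    obtain q where q: "sublinear q" "\<And>x. q x \<le> m x"
        "\<And>x t. t \<ge> 0 \<Longrightarrow> q x \<le> m (x + t *\<^sub>R y) - t * m y"
      using sublinear_shift[OF m(1), where v = y] by metis
    have "q = m" using q by (intro min) (auto simp: le_fun_def)
    then have "m x \<le> m (x + y) - m y" using q(3)[of 1 x] by simp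
    then show ?thesis using sublinear_add[OF m(1), of x y] by simp
  qed
  have neg: "m (- x) = - m x" for x
    using add[of x "- x"] sublinear_zero[OF m(1)] by simp
  have "linear m"
  proof (rule linearI)
    show "m (c *\<^sub>R x) = c *\<^sub>R m x" for c x
    proof (cases "c \<ge> 0")
      case True
      then show ?thesis using sublinear_scaleR[OF m(1)] by simp
    next
      case False
      then have "m ((- c) *\<^sub>R x) = - c * m x" by (intro sublinear_scaleR[OF m(1)]) simp
      then show ?thesis using neg[of "c *\<^sub>R x"] by simp
    qed
  qed (rule add)
  moreover have le: "m x \<le> p x" for x
    using m(2) p'(2)[of x] by (meson le_fun_def order_trans)
  moreover have "m x0 = p x0"
  proof -
    have "m (- x0) \<le> p' (- x0)" using m(2) by (auto simp: le_fun_def)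
    also have "\<dots> \<le> - p x0" using p'(3)[of 1 "- x0"] sublinear_zero[OF assms] by simp
    finally show ?thesis using neg[of x0] le[of x0] by simp
  qed
  ultimately show ?thesis using that by blast
qed

section \<open>Functionals dominated by the distance to a subspace\<close>

lemma sublinear_infdist:
  fixes N :: "'a::real_normed_vector set"
  assumes "subspace N"
  shows "sublinear (\<lambda>x. infdist x N)"
proof -
  have ne: "N \<noteq> {}" using assms subspace_0 by auto
  have ge: "c \<le> infdist x N" if "\<And>a. a \<in> N \<Longrightarrow> c \<le> dist x a" for c x
    using that ne by (simp add: infdist_notempty cINF_greatest)
  have "infdist (x + y) N \<le> infdist x N + infdist y N" for x y
  proof -
    have "infdist (x + y) N - dist y b \<le> infdist x N" if b: "b \<in> N" for b
    proof (rule ge)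
      fix a assume a: "a \<in> N"
      have "infdist (x + y) N \<le> dist (x + y) (a + b)"
        using a b assms by (intro infdist_le subspace_add)
      also have "\<dots> \<le> dist x a + dist y b" by (rule dist_triangle_add)
      finally show "infdist (x + y) N - dist y b \<le> dist x a" by simp
    qed
    then have "infdist (x + y) N - infdist x N \<le> dist y b" if "b \<in> N" for b
      using that by (simp add: algebra_simps)
    from ge[OF this] show ?thesis by simp
  qed
  moreover have "infdist (c *\<^sub>R x) N \<le> c * infdist x N" if c: "c > 0" for c x
  proof -
    have "infdist (c *\<^sub>R x) N / c \<le> dist x a" if a: "a \<in> N" for a
    proof -
      have "infdist (c *\<^sub>R x) N \<le> dist (c *\<^sub>R x) (c *\<^sub>R a)"
        using a assms by (intro infdist_le subspace_scale)
      also have "\<dots> = c * dist x a"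
        using c by (simp add: dist_norm flip: scaleR_right_diff_distrib)
      finally show ?thesis using c by (simp add: field_simps)
    qed
    from ge[OF this] show ?thesis using c by (simp add: field_simps)
  qed
  ultimately show ?thesis by (simp add: sublinear_def)
qed

text \<open>Domination by the distance carries two facts at once: \<open>\<phi>\<close> vanishes on
  \<open>N\<close> and has norm at most one. The case \<open>N = {0}\<close> gives norming
  functionals; a general \<open>N\<close> gives detection of points outside its closure.\<close>

theorem Hahn_Banach_infdist:
  fixes N :: "'a::real_normed_vector set"
  assumes "subspace N"
  obtains \<phi> :: "'a \<Rightarrow>\<^sub>L real" where "\<And>x. \<bar>\<phi> x\<bar> \<le> infdist x N" "\<phi> x0 = infdist x0 N"
proof -
  obtain f where f: "linear f" "\<And>x. f x \<le> infdist x N" "f x0 = infdist x0 N"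
    using Hahn_Banach_sublinear[OF sublinear_infdist[OF assms]] by metis
  \<comment> \<open>Symmetry of the distance turns the one-sided domination into a bound for the
    absolute value.\<close>
  have "infdist (- x) N \<le> infdist x N" for x
  proof -
    have "infdist (- x) N \<le> dist x a" if a: "a \<in> N" for a
    proof -
      have "infdist (- x) N \<le> dist (- x) (- a)" using a assms by (intro infdist_le subspace_neg)
      then show ?thesis by (simp add: dist_norm norm_minus_commute)
    qed
    moreover have "N \<noteq> {}" using assms subspace_0 by auto
    ultimately show ?thesis by (simp add: infdist_notempty[of _ x] cINF_greatest)
  qed
  then have "- f x \<le> infdist x N" for x
    using f(2)[of "- x"] linear_neg[OF f(1), of x] by (metis order_trans)
  with f(2) have abs: "\<bar>f x\<bar> \<le> infdist x N" for x by (simp add: abs_le_iff)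
  have "infdist x N \<le> norm x" for x
    using infdist_le[OF subspace_0[OF assms], of x] by simp
  then have "\<bar>f x\<bar> \<le> norm x * 1" for x using abs[of x] by (metis order_trans mult.right_neutral)
  then have "bounded_linear f"
    using f(1) by (intro bounded_linear_intro[where K = 1]) (auto simp: linear_add linear_scale)
  then have "blinfun_apply (Blinfun f) = f" by (rule bounded_linear_Blinfun_apply)
  with abs f(3) that[of "Blinfun f"] show ?thesis by simp
qed

lemma norming_functional:
  fixes x :: "'a::real_normed_vector"
  obtains \<phi> :: "'a \<Rightarrow>\<^sub>L real" where "norm \<phi> \<le> 1" "\<phi> x = norm x"
proof -
  obtain \<phi> :: "'a \<Rightarrow>\<^sub>L real" where \<phi>: "\<And>y. \<bar>\<phi> y\<bar> \<le> infdist y {0}" "\<phi> x = infdist x {0}"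
    using Hahn_Banach_infdist[OF subspace_single_0] by metis
  have "norm \<phi> \<le> 1" using \<phi>(1) by (intro norm_blinfun_bound) auto
  with \<phi>(2) that show ?thesis by simp
qed

lemma eq_if_functionals_eq:
  fixes x y :: "'a::real_normed_vector"
  assumes "\<And>\<phi> :: 'a \<Rightarrow>\<^sub>L real. \<phi> x = \<phi> y"
  shows "x = y"
proof -
  obtain \<phi> :: "'a \<Rightarrow>\<^sub>L real" where "\<phi> (x - y) = norm (x - y)" by (rule norming_functional)
  with assms[of \<phi>] show ?thesis by (simp add: blinfun.diff_right)
qed

text \<open>Mazur's theorem for subspaces: a functional that vanishes on \<open>N\<close> and equals
  the distance at \<open>l\<close> is zero along the sequence, so the distance is zero.\<close>

lemma closure_subspace_weak_limit:
  fixes N :: "'a::real_normed_vector set"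
  assumes "subspace N" "\<And>n. f n \<in> N" "\<And>\<phi> :: 'a \<Rightarrow>\<^sub>L real. (\<lambda>n. \<phi> (f n)) \<longlonglongrightarrow> \<phi> l"
  shows "l \<in> closure N"
proof -
  obtain \<phi> :: "'a \<Rightarrow>\<^sub>L real" where \<phi>: "\<And>x. \<bar>\<phi> x\<bar> \<le> infdist x N" "\<phi> l = infdist l N"
    using Hahn_Banach_infdist[OF assms(1)] by metis
  have "\<phi> (f n) = 0" for n using \<phi>(1)[of "f n"] assms(2)[of n] by simp
  with assms(3)[of \<phi>] have "\<phi> l = 0" by (simp add: LIMSEQ_const_iff)
  with \<phi>(2) assms(1) show ?thesis by (metis in_closure_iff_infdist_zero empty_iff subspace_0)
qed

text \<open>A norming functional at the limit gives weak lower semicontinuity of the norm. This is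
  how increment estimates for approximants reach their weak limits.\<close>

lemma weak_limit_norm_le:
  fixes f :: "nat \<Rightarrow> 'a::real_normed_vector"
  assumes "\<And>\<phi> :: 'a \<Rightarrow>\<^sub>L real. (\<lambda>n. \<phi> (f n)) \<longlonglongrightarrow> \<phi> l" "eventually (\<lambda>n. norm (f n) \<le> c) sequentially"
  shows "norm l \<le> c"
proof -
  obtain \<phi> :: "'a \<Rightarrow>\<^sub>L real" where \<phi>: "norm \<phi> \<le> 1" "\<phi> l = norm l" by (rule norming_functional)
  have "eventually (\<lambda>n. \<phi> (f n) \<le> c) sequentially"
    using assms(2)
  proof eventually_elim
    case (elim n)
    have "\<phi> (f n) \<le> norm \<phi> * norm (f n)" using norm_blinfun[of \<phi> "f n"] by simp
    also have "\<dots> \<le> 1 * norm (f n)" using \<phi>(1) by (intro mult_right_mono) auto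
    finally show ?case using elim by simp
  qed
  with assms(1)[of \<phi>] have "\<phi> l \<le> c" by (intro tendsto_upperbound) auto
  with \<phi>(2) show ?thesis by simp
qed

text \<open>The weak limits of ever better approximants form a Cauchy sequence by lower
  semicontinuity of the norm; completeness supplies the weak limit of \<open>f\<close>.\<close>

lemma weakly_convergent_approx:
  fixes f :: "nat \<Rightarrow> 'a::banach"
  assumes approx: "\<And>e. e > 0 \<Longrightarrow>
    \<exists>g. weakly_convergent g \<and> (\<forall>\<^sub>F n in sequentially. norm (f n - g n) \<le> e)"
  shows "weakly_convergent f"
proof -
  have "\<exists>g l. (\<forall>\<phi>::'a \<Rightarrow>\<^sub>L real. (\<lambda>n. \<phi> (g n)) \<longlonglongrightarrow> \<phi> l) \<and>
      (\<forall>\<^sub>F n in sequentially. norm (f n - g n) \<le> 1 / real (Suc k))" for k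
    using approx[of "1 / real (Suc k)"] unfolding weakly_convergent_def by auto
  then obtain g l where lim: "\<And>k (\<phi>::'a \<Rightarrow>\<^sub>L real). (\<lambda>n. \<phi> (g k n)) \<longlonglongrightarrow> \<phi> (l k)"
    and near: "\<And>k. \<forall>\<^sub>F n in sequentially. norm (f n - g k n) \<le> 1 / real (Suc k)"
    by metis
  have diff: "norm (l j - l k) \<le> 1 / real (Suc j) + 1 / real (Suc k)" for j k
  proof (rule weak_limit_norm_le)
    show "(\<lambda>n. \<phi> (g j n - g k n)) \<longlonglongrightarrow> \<phi> (l j - l k)" for \<phi> :: "'a \<Rightarrow>\<^sub>L real"
      using tendsto_diff[OF lim lim] by (simp add: blinfun.diff_right)
    show "\<forall>\<^sub>F n in sequentially. norm (g j n - g k n) \<le> 1 / real (Suc j) + 1 / real (Suc k)"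
      using near[of j] near[of k]
    proof eventually_elim
      case (elim n)
      have "norm (g j n - g k n) = norm ((f n - g k n) - (f n - g j n))" by simp
      also have "\<dots> \<le> norm (f n - g k n) + norm (f n - g j n)" by (rule norm_triangle_ineq4)
      finally show ?case using elim by simp
    qed
  qed
  have small: "\<exists>N. \<forall>k\<ge>N. 1 / real (Suc k) < e" if "e > 0" for e :: real
    using order_tendstoD(2)[OF LIMSEQ_Suc[OF lim_1_over_n] that]
    by (simp add: eventually_sequentially)
  have "Cauchy l"
  proof (rule CauchyI)
    fix e :: real assume "e > 0"
    then obtain N where N: "\<And>k. k \<ge> N \<Longrightarrow> 1 / real (Suc k) < e / 2"
      using small[of "e / 2"] by auto
    have "norm (l m - l n) < e" if "m \<ge> N" "n \<ge> N" for m n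
      using diff[of m n] N[OF that(1)] N[OF that(2)] by simp
    then show "\<exists>N. \<forall>m\<ge>N. \<forall>n\<ge>N. norm (l m - l n) < e" by blast
  qed
  then obtain L where L: "l \<longlonglongrightarrow> L" using convergent_eq_Cauchy by blast
  have "(\<lambda>n. \<phi> (f n)) \<longlonglongrightarrow> \<phi> L" for \<phi> :: "'a \<Rightarrow>\<^sub>L real"
  proof (rule metric_LIMSEQ_I)
    fix r :: real assume r: "r > 0"
    define e where "e = r / (3 * (norm \<phi> + 1))"
    have den: "norm \<phi> + 1 > 0" by (simp add: add_nonneg_pos)
    have e: "e > 0" "norm \<phi> * e \<le> r / 3"
      using r den unfolding e_def by (auto simp: field_simps)
    obtain N where N: "\<And>k. k \<ge> N \<Longrightarrow> 1 / real (Suc k) < e" using small[OF e(1)] by auto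
    obtain N' where N': "\<And>k. k \<ge> N' \<Longrightarrow> norm (l k - L) < e"
      using LIMSEQ_D[OF L e(1)] by auto
    define k where "k = max N N'"
    have k: "1 / real (Suc k) < e" "norm (l k - L) < e"
      using N[of k] N'[of k] by (simp_all add: k_def)
    have "\<forall>\<^sub>F n in sequentially. dist (\<phi> (g k n)) (\<phi> (l k)) < r / 3"
      using lim[of \<phi> k] r by (intro tendstoD) auto
    with near[of k] have "\<forall>\<^sub>F n in sequentially. dist (\<phi> (f n)) (\<phi> L) < r"
    proof eventually_elim
      case (elim n)
      have "\<phi> (f n) - \<phi> L = \<phi> (f n - g k n) + (\<phi> (g k n) - \<phi> (l k)) + \<phi> (l k - L)"
        by (simp add: blinfun.diff_right)
      moreover have "\<bar>\<phi> (f n - g k n)\<bar> \<le> r / 3"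
      proof -
        have "\<bar>\<phi> (f n - g k n)\<bar> \<le> norm \<phi> * norm (f n - g k n)"
          using norm_blinfun[of \<phi> "f n - g k n"] by simp
        also have "\<dots> \<le> norm \<phi> * e" using elim k by (intro mult_left_mono) auto
        finally show ?thesis using e by simp
      qed
      moreover have "\<bar>\<phi> (l k - L)\<bar> \<le> r / 3"
      proof -
        have "\<bar>\<phi> (l k - L)\<bar> \<le> norm \<phi> * norm (l k - L)"
          using norm_blinfun[of \<phi> "l k - L"] by simp
        also have "\<dots> \<le> norm \<phi> * e" using k by (intro mult_left_mono) auto
        finally show ?thesis using e by simp
      qed
      ultimately show ?case using elim(2) unfolding dist_real_def by linarith
    qed
    then show "\<exists>no. \<forall>n\<ge>no. dist (\<phi> (f n)) (\<phi> L) < r" by (simp add: eventually_sequentially)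
  qed
  then show ?thesis unfolding weakly_convergent_def by blast
qed

subsection \<open>Strongly continuous semigroups\<close>

text \<open>Baire category: the closed sets \<open>E k\<close> of points with common bound
  \<open>k\<close> cover the space, so one of them contains a ball.\<close>

theorem uniform_boundedness:
  fixes F :: "('a::banach \<Rightarrow>\<^sub>L 'b::real_normed_vector) set"
  assumes bdd: "\<And>x. \<exists>c. \<forall>A\<in>F. norm (blinfun_apply A x) \<le> c"
  obtains K where "\<And>A. A \<in> F \<Longrightarrow> norm A \<le> K"
proof -
  define E where "E k = {x. \<forall>A\<in>F. norm (blinfun_apply A x) \<le> real k}" for k :: nat
  have closed: "closed (E k)" for k
  proof -
    have "E k = (\<Inter>A\<in>F. {x. norm (blinfun_apply A x) \<le> real k})" by (auto simp: E_def)
    also have "closed \<dots>"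
      by (intro closed_INT ballI closed_Collect_le continuous_intros)
    finally show ?thesis .
  qed
  have cover: "(\<Union>k. E k) = UNIV"
  proof -
    have "\<exists>k. x \<in> E k" for x
    proof -
      obtain c where c: "\<forall>A\<in>F. norm (blinfun_apply A x) \<le> c" using bdd by blast
      obtain k where "c \<le> real k" using real_arch_simple by blast
      with c have "x \<in> E k" by (auto simp: E_def intro: order_trans)
      then show ?thesis ..
    qed
    then show ?thesis by auto
  qed
  have "\<exists>k. interior (E k) \<noteq> {}"
  proof (rule ccontr)
    assume "\<not> ?thesis"
    then have "euclidean interior_of \<Union>(range E) = {}"
      using closed
      by (intro Baire_category_alt) (auto simp: completely_metrizable_space_euclidean)
    with cover show False by simp
  qed
  then obtain k x where "x \<in> interior (E k)" by blast
  then obtain r where r: "r > 0" "cball x r \<subseteq> E k" by (meson mem_interior_cball)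
  have "norm A \<le> 2 * real k / r" if A: "A \<in> F" for A
  proof (rule norm_blinfun_bound)
    show "0 \<le> 2 * real k / r" using r by simp
    fix y
    show "norm (blinfun_apply A y) \<le> 2 * real k / r * norm y"
    proof (cases "y = 0")
      case False
      \<comment> \<open>\<open>y\<close> is rescaled to the radius of the ball, so
        \<open>A z\<close> is a difference of two values of norm at most \<open>k\<close>.\<close>
      define z where "z = (r / norm y) *\<^sub>R y"
      have nz: "norm z = r" using False r by (simp add: z_def)
      have "x + z \<in> E k" "x \<in> E k" using r nz by (auto simp: dist_norm)
      then have "norm (blinfun_apply A (x + z)) \<le> k" "norm (blinfun_apply A x) \<le> k"
        using A by (auto simp: E_def)
      moreover have "A z = A (x + z) - A x" by (simp add: blinfun.add_right)
      ultimately have "norm (blinfun_apply A z) \<le> 2 * real k"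
        using norm_triangle_ineq4[of "blinfun_apply A (x + z)" "blinfun_apply A x"] by simp
      then show ?thesis
        using False r by (simp add: z_def blinfun.scaleR_right field_simps)
    qed simp
  qed
  then show ?thesis using that by blast
qed

lemma c0_semigroup_zero: "c0_semigroup T \<Longrightarrow> T 0 = id_blinfun"
  and c0_semigroup_add:
    "c0_semigroup T \<Longrightarrow> s \<ge> 0 \<Longrightarrow> r \<ge> 0 \<Longrightarrow> T (s + r) x = T s (T r x)"
  and c0_semigroup_tendsto: "c0_semigroup T \<Longrightarrow> ((\<lambda>s. T s x) \<longlongrightarrow> x) (at_right 0)"
  by (simp_all add: c0_semigroup_def)

text \<open>The definition grants strong continuity at 0 only. Unbounded norms along times tending
  to 0 would contradict uniform boundedness, because every orbit converges along them.\<close>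

lemma c0_semigroup_bounded_near_0:
  fixes T :: "real \<Rightarrow> 'a::banach \<Rightarrow>\<^sub>L 'a"
  assumes T: "c0_semigroup T"
  obtains d K where "d > 0" "\<And>s. 0 \<le> s \<Longrightarrow> s < d \<Longrightarrow> norm (T s) \<le> K"
proof -
  have "\<exists>n::nat. \<forall>s. 0 \<le> s \<and> s < inverse (real (Suc n)) \<longrightarrow> norm (T s) \<le> 1 + real n"
  proof (rule ccontr)
    assume "\<not> ?thesis"
    then have "\<forall>n::nat. \<exists>s. 0 \<le> s \<and> s < inverse (real (Suc n)) \<and> norm (T s) > 1 + real n"
      by (auto simp: not_le)
    then obtain h where h: "\<And>n. 0 \<le> h n" "\<And>n. h n < inverse (real (Suc n))"
        "\<And>n::nat. norm (T (h n)) > 1 + real n"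
      by metis
    \<comment> \<open>The one-sided limit ignores time 0, so this value has to be excluded; the norm
      of the identity never exceeds the threshold \<open>1 + real n\<close>.\<close>
    have "h n \<noteq> 0" for n
    proof
      assume "h n = 0"
      then have "norm (T (h n)) \<le> 1" using T by (simp add: c0_semigroup_zero norm_blinfun_id_le)
      with h(3)[of n] show False by simp
    qed
    then have pos: "h n > 0" for n using h(1)[of n] by (simp add: less_le)
    have "h \<longlonglongrightarrow> 0"
      using h(1) h(2) LIMSEQ_inverse_real_of_nat
      by (intro tendsto_sandwich[of "\<lambda>_. 0" h sequentially "\<lambda>n. inverse (real (Suc n))"])
        (auto simp: less_imp_le)
    then have lim: "filterlim h (at_right 0) sequentially"
      using pos by (intro filterlim_at_withinI) (auto simp: greaterThan_def)
    have bdd: "\<exists>c. \<forall>A\<in>range (\<lambda>n. T (h n)). norm (blinfun_apply A x) \<le> c" for x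
    proof -
      have "(\<lambda>n. T (h n) x) \<longlonglongrightarrow> x" by (rule filterlim_compose[OF c0_semigroup_tendsto[OF T] lim])
      then have "Bseq (\<lambda>n. T (h n) x)" by (intro convergent_imp_Bseq convergentI)
      then obtain c where "\<And>n. norm (T (h n) x) \<le> c" by (auto simp: Bseq_def)
      then show ?thesis by auto
    qed
    obtain K where K: "\<And>A. A \<in> range (\<lambda>n. T (h n)) \<Longrightarrow> norm A \<le> K"
      using uniform_boundedness[OF bdd] by blast
    obtain n :: nat where "K \<le> real n" using real_arch_simple by blast
    with K[of "T (h n)"] h(3)[of n] show False by auto
  qed
  then obtain n :: nat
    where "\<And>s. 0 \<le> s \<Longrightarrow> s < inverse (real (Suc n)) \<Longrightarrow> norm (T s) \<le> 1 + real n"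
    by blast
  then show ?thesis by (intro that[of "inverse (real (Suc n))"]) auto
qed

lemma c0_semigroup_bounded:
  fixes T :: "real \<Rightarrow> 'a::banach \<Rightarrow>\<^sub>L 'a"
  assumes T: "c0_semigroup T"
  obtains K where "K \<ge> 1" "\<And>s. 0 \<le> s \<Longrightarrow> s \<le> R \<Longrightarrow> norm (T s) \<le> K"
proof -
  obtain d K0 where d: "d > 0" and K0: "\<And>s. 0 \<le> s \<Longrightarrow> s < d \<Longrightarrow> norm (T s) \<le> K0"
    using c0_semigroup_bounded_near_0[OF T] by metis
  define L where "L = max 1 K0"
  have L: "L \<ge> 1" "\<And>s. 0 \<le> s \<Longrightarrow> s < d \<Longrightarrow> norm (T s) \<le> L"
    using K0 by (auto simp: L_def intro: le_max_iff_disj[THEN iffD2])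
  have pow: "norm (T s) \<le> L ^ n" if "0 \<le> s" "s \<le> real n * (d / 2)" for n s
    using that
  proof (induction n arbitrary: s)
    case 0
    then have "s = 0" by simp
    then show ?case using T by (simp add: c0_semigroup_zero norm_blinfun_id_le)
  next
    case (Suc n)
    show ?case
    proof (cases "s < d / 2")
      case True
      then have "norm (T s) \<le> L" using Suc d by (intro L) auto
      also have "\<dots> \<le> L ^ Suc n" using L(1) by (intro self_le_power) auto
      finally show ?thesis .
    next
      case False
      have "T s = T (d / 2) o\<^sub>L T (s - d / 2)"
        using c0_semigroup_add[OF T, of "d / 2" "s - d / 2"] False d
        by (intro blinfun_eqI) simp
      then have "norm (T s) \<le> norm (T (d / 2)) * norm (T (s - d / 2))"
        using norm_blinfun_compose by metis
      also have "\<dots> \<le> L * L ^ n"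
        using Suc.prems False d L(1) by (intro mult_mono L Suc.IH) (auto simp: algebra_simps)
      finally show ?thesis by simp
    qed
  qed
  obtain n :: nat where n: "R / (d / 2) \<le> real n" using real_arch_simple by blast
  have "norm (T s) \<le> L ^ n" if "0 \<le> s" "s \<le> R" for s
    using that n d by (intro pow) (auto simp: field_simps)
  moreover have "L ^ n \<ge> 1" using L(1) by simp
  ultimately show ?thesis using that by blast
qed

text \<open>The abstract Cauchy problem for \<open>\<Gamma>\<close> with derivative
  \<open>w\<close>. The derivative is a one-sided increment estimate, uniform in \<open>s\<close> on
  bounded intervals: it can be summed over subdivisions without integrating \<open>w\<close>, and it
  is inherited by weak limits.\<close>

definition classical_solution ::
    "('a::real_normed_vector \<times> 'a) set \<Rightarrow> (real \<Rightarrow> 'a) \<Rightarrow> (real \<Rightarrow> 'a) \<Rightarrow> bool" where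
  "classical_solution \<Gamma> u w \<longleftrightarrow>
     (\<forall>s\<ge>0. (u s, w s) \<in> \<Gamma>) \<and> continuous_on {0..} w \<and>
     (\<forall>R. \<forall>e>0. \<exists>d>0. \<forall>s h. 0 \<le> s \<and> s \<le> R \<and> 0 < h \<and> h < d \<longrightarrow>
        norm (u (s + h) - u s - h *\<^sub>R w s) \<le> e * h)"

text \<open>Uniformity in the base point makes a one-sided modulus sufficient: for
  \<open>r < s\<close> the estimate is used with base \<open>r\<close>.\<close>

lemma continuous_on_nonnegI:
  fixes w :: "real \<Rightarrow> 'a::real_normed_vector"
  assumes "\<And>R e. e > 0 \<Longrightarrow>
    \<exists>d>0. \<forall>s h. 0 \<le> s \<and> s \<le> R \<and> 0 < h \<and> h < d \<longrightarrow> norm (w (s + h) - w s) \<le> e"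
  shows "continuous_on {0..} w"
  unfolding continuous_on_iff
proof (intro ballI allI impI)
  fix s e :: real assume s: "s \<in> {0..}" and e: "e > 0"
  obtain d where d: "d > 0" and
    *: "\<And>r h. 0 \<le> r \<Longrightarrow> r \<le> s + 1 \<Longrightarrow> 0 < h \<Longrightarrow> h < d \<Longrightarrow> norm (w (r + h) - w r) \<le> e / 2"
    using assms[of "e / 2" "s + 1"] e by auto
  have "dist (w r) (w s) < e" if r: "r \<in> {0..}" "dist r s < min d 1" for r
  proof -
    consider "r = s" | "r < s" | "s < r" by linarith
    then have "norm (w r - w s) \<le> e / 2"
    proof cases
      case 2
      then show ?thesis
        using *[of r "s - r"] r s by (simp add: dist_real_def norm_minus_commute)
    next
      case 3
      then show ?thesis using *[of s "r - s"] r s by (simp add: dist_real_def)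
    qed (use e in simp)
    then show ?thesis using e by (simp add: dist_norm)
  qed
  then show "\<exists>d>0. \<forall>r\<in>{0..}. dist r s < d \<longrightarrow> dist (w r) (w s) < e"
    using d by (intro exI[of _ "min d 1"]) auto
qed

lemma eventually_at_right_0_D:
  assumes "eventually P (at_right (0::real))"
  obtains d where "d > 0" "\<And>h. 0 < h \<Longrightarrow> h < d \<Longrightarrow> P h"
  using assms by (auto simp: eventually_at_right_field)

lemma strong_deriv0_iff:
  "(x, y) \<in> strong_deriv0 T \<longleftrightarrow>
    (\<forall>e>0. \<exists>d>0. \<forall>h. 0 < h \<and> h < d \<longrightarrow> norm (T h x - x - h *\<^sub>R y) \<le> e * h)"
proof -
  have eq: "norm ((T h x - x) /\<^sub>R h - y) = norm (T h x - x - h *\<^sub>R y) / h" if "h > 0" for h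
  proof -
    have "(T h x - x) /\<^sub>R h - y = (T h x - x - h *\<^sub>R y) /\<^sub>R h"
      using that by (simp add: scaleR_diff_right)
    then show ?thesis using that by (simp add: divide_inverse mult.commute)
  qed
  show ?thesis
  proof
    assume "(x, y) \<in> strong_deriv0 T"
    then have lim: "((\<lambda>h. (T h x - x) /\<^sub>R h) \<longlongrightarrow> y) (at_right 0)" by (simp add: strong_deriv0_def)
    show "\<forall>e>0. \<exists>d>0. \<forall>h. 0 < h \<and> h < d \<longrightarrow> norm (T h x - x - h *\<^sub>R y) \<le> e * h"
    proof (intro allI impI)
      fix e :: real assume "e > 0"
      from tendstoD[OF lim this] obtain d where "d > 0"
        and d: "\<And>h. 0 < h \<Longrightarrow> h < d \<Longrightarrow> dist ((T h x - x) /\<^sub>R h) y < e"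
        by (rule eventually_at_right_0_D) blast
      have "norm (T h x - x - h *\<^sub>R y) \<le> e * h" if "0 < h" "h < d" for h
      proof -
        have "norm (T h x - x - h *\<^sub>R y) / h < e" using d[OF that] eq[OF that(1)] by (simp add: dist_norm)
        then show ?thesis using that by (simp add: pos_divide_less_eq)
      qed
      with \<open>d > 0\<close> show "\<exists>d>0. \<forall>h. 0 < h \<and> h < d \<longrightarrow> norm (T h x - x - h *\<^sub>R y) \<le> e * h"
        by blast
    qed
  next
    assume *: "\<forall>e>0. \<exists>d>0. \<forall>h. 0 < h \<and> h < d \<longrightarrow> norm (T h x - x - h *\<^sub>R y) \<le> e * h"
    have "((\<lambda>h. (T h x - x) /\<^sub>R h) \<longlongrightarrow> y) (at_right 0)"
    proof (rule tendstoI)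
      fix e :: real assume e: "e > 0"
      then obtain d where "d > 0"
        and d: "\<And>h. 0 < h \<Longrightarrow> h < d \<Longrightarrow> norm (T h x - x - h *\<^sub>R y) \<le> e / 2 * h"
        using * by (meson half_gt_zero)
      have "dist ((T h x - x) /\<^sub>R h) y < e" if "0 < h" "h < d" for h
      proof -
        have "norm (T h x - x - h *\<^sub>R y) / h \<le> e / 2" using d[OF that] that by (simp add: field_simps)
        also have "\<dots> < e" using e by simp
        finally show ?thesis using eq[OF that(1)] by (simp add: dist_norm)
      qed
      with \<open>d > 0\<close> show "\<forall>\<^sub>F h in at_right 0. dist ((T h x - x) /\<^sub>R h) y < e"
        unfolding eventually_at_right_field by auto
    qed
    then show "(x, y) \<in> strong_deriv0 T" by (simp add: strong_deriv0_def)
  qed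
qed

lemma generates_invariant:
  fixes U :: "real \<Rightarrow> 'a::banach \<Rightarrow>\<^sub>L 'a"
  assumes U: "generates \<Gamma> U" and xy: "(x, y) \<in> \<Gamma>" and s: "s \<ge> 0"
  shows "(U s x, U s y) \<in> \<Gamma>"
proof -
  have c0: "c0_semigroup U" and \<Gamma>: "\<Gamma> = strong_deriv0 U" using U by (auto simp: generates_def)
  have "((\<lambda>h. U s ((U h x - x) /\<^sub>R h)) \<longlongrightarrow> U s y) (at_right 0)"
    using xy unfolding \<Gamma> strong_deriv0_def by (auto intro!: tendsto_intros)
  moreover have "U s ((U h x - x) /\<^sub>R h) = (U h (U s x) - U s x) /\<^sub>R h" if "h > 0" for h
    using c0_semigroup_add[OF c0, of s h x] c0_semigroup_add[OF c0, of h s x] s that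
    by (simp add: blinfun.scaleR_right blinfun.diff_right add.commute)
  then have "\<forall>\<^sub>F h in at_right 0. U s ((U h x - x) /\<^sub>R h) = (U h (U s x) - U s x) /\<^sub>R h"
    by (auto simp: eventually_at_right_field intro!: exI[of _ 1])
  ultimately have "((\<lambda>h. (U h (U s x) - U s x) /\<^sub>R h) \<longlongrightarrow> U s y) (at_right 0)"
    by (rule Lim_transform_eventually)
  then show ?thesis by (simp add: \<Gamma> strong_deriv0_def)
qed

text \<open>Estimates at time 0 are moved to time \<open>s\<close> by applying \<open>U s\<close>;
  the bound \<open>K\<close> of its norm on \<open>[0, R]\<close> is paid for by starting from
  \<open>e / K\<close>.\<close>

lemma generates_classical_solution:
  fixes U :: "real \<Rightarrow> 'a::banach \<Rightarrow>\<^sub>L 'a"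
  assumes U: "generates \<Gamma> U" and xy: "(x, y) \<in> \<Gamma>"
  shows "classical_solution \<Gamma> (\<lambda>s. U s x) (\<lambda>s. U s y)"
proof -
  have c0: "c0_semigroup U" and \<Gamma>: "\<Gamma> = strong_deriv0 U" using U by (auto simp: generates_def)
  have bound: "norm (U s z) \<le> K * b" if "norm (U s) \<le> K" "norm z \<le> b" for s z K b
    using norm_blinfun[of "U s" z] that by (meson mult_mono norm_ge_zero order_trans)
  have "continuous_on {0..} (\<lambda>s. U s y)"
  proof (rule continuous_on_nonnegI)
    fix R e :: real assume e: "e > 0"
    obtain K where K: "K \<ge> 1" "\<And>s. 0 \<le> s \<Longrightarrow> s \<le> R \<Longrightarrow> norm (U s) \<le> K"
      using c0_semigroup_bounded[OF c0] by metis
    have "e / K > 0" using K e by simp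
    from tendstoD[OF c0_semigroup_tendsto[OF c0, of y] this] obtain d where "d > 0"
      and d: "\<And>h. 0 < h \<Longrightarrow> h < d \<Longrightarrow> dist (U h y) y < e / K"
      by (rule eventually_at_right_0_D) blast
    have "norm (U (s + h) y - U s y) \<le> e" if "0 \<le> s" "s \<le> R" "0 < h" "h < d" for s h
    proof -
      have "U (s + h) y - U s y = U s (U h y - y)"
        using c0_semigroup_add[OF c0, of s h] that by (simp add: blinfun.diff_right)
      also have "norm \<dots> \<le> K * (e / K)"
        using K(2)[OF that(1,2)] d[OF that(3,4)] by (intro bound) (auto simp: dist_norm)
      finally show ?thesis using K by simp
    qed
    with \<open>d > 0\<close> show "\<exists>d>0. \<forall>s h. 0 \<le> s \<and> s \<le> R \<and> 0 < h \<and> h < d \<longrightarrow> norm (U (s + h) y - U s y) \<le> e"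
      by blast
  qed
  moreover have "\<exists>d>0. \<forall>s h. 0 \<le> s \<and> s \<le> R \<and> 0 < h \<and> h < d \<longrightarrow>
      norm (U (s + h) x - U s x - h *\<^sub>R U s y) \<le> e * h" if e: "e > 0" for R e
  proof -
    obtain K where K: "K \<ge> 1" "\<And>s. 0 \<le> s \<Longrightarrow> s \<le> R \<Longrightarrow> norm (U s) \<le> K"
      using c0_semigroup_bounded[OF c0] by metis
    have "e / K > 0" using K e by simp
    with xy obtain d where "d > 0"
      and d: "\<And>h. 0 < h \<Longrightarrow> h < d \<Longrightarrow> norm (U h x - x - h *\<^sub>R y) \<le> (e / K) * h"
      unfolding \<Gamma> strong_deriv0_iff by meson
    have "norm (U (s + h) x - U s x - h *\<^sub>R U s y) \<le> e * h"
      if "0 \<le> s" "s \<le> R" "0 < h" "h < d" for s h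
    proof -
      have "U (s + h) x - U s x - h *\<^sub>R U s y = U s (U h x - x - h *\<^sub>R y)"
        using c0_semigroup_add[OF c0, of s h] that
        by (simp add: blinfun.diff_right blinfun.scaleR_right)
      also have "norm \<dots> \<le> K * ((e / K) * h)"
        using K(2)[OF that(1,2)] d[OF that(3,4)] by (rule bound)
      finally show ?thesis using K by simp
    qed
    with \<open>d > 0\<close> show ?thesis by blast
  qed
  ultimately show ?thesis
    using generates_invariant[OF U xy] by (simp add: classical_solution_def)
qed

section \<open>Powers of bounded operators, telescoping sums and rounded times\<close>

lemma funpow_blinfun_add:
  fixes A :: "'a::real_normed_vector \<Rightarrow>\<^sub>L 'a"
  shows "(blinfun_apply A ^^ m) (x + y) = (blinfun_apply A ^^ m) x + (blinfun_apply A ^^ m) y"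
  by (induction m) (simp_all add: blinfun.add_right)

lemma funpow_blinfun_diff:
  fixes A :: "'a::real_normed_vector \<Rightarrow>\<^sub>L 'a"
  shows "(blinfun_apply A ^^ m) (x - y) = (blinfun_apply A ^^ m) x - (blinfun_apply A ^^ m) y"
  by (induction m) (simp_all add: blinfun.diff_right)

lemma funpow_blinfun_scaleR:
  fixes A :: "'a::real_normed_vector \<Rightarrow>\<^sub>L 'a"
  shows "(blinfun_apply A ^^ m) (c *\<^sub>R x) = c *\<^sub>R (blinfun_apply A ^^ m) x"
  by (induction m) (simp_all add: blinfun.scaleR_right)

lemma funpow_blinfun_telescope:
  fixes A :: "'a::real_normed_vector \<Rightarrow>\<^sub>L 'a"
  assumes "l \<le> m"
  shows "(blinfun_apply A ^^ m) x - (blinfun_apply A ^^ l) x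
    = (\<Sum>k=l..<m. (blinfun_apply A ^^ k) (A x - x))"
  using sum_Suc_diff'[OF assms, of "\<lambda>k. (blinfun_apply A ^^ k) x"]
  by (simp add: funpow_blinfun_diff funpow_swap1)

lemma norm_sum_atLeastLessThan_le:
  fixes f :: "nat \<Rightarrow> 'a::real_normed_vector"
  assumes "\<And>k. l \<le> k \<Longrightarrow> k < m \<Longrightarrow> norm (f k) \<le> c"
  shows "norm (\<Sum>k=l..<m. f k) \<le> real (m - l) * c"
  using sum_norm_le[of "{l..<m}" f "\<lambda>_. c"] assms by simp

lemma nat_floor_mult_le:
  assumes "\<tau> > 0" "r \<ge> 0"
  shows "real (nat \<lfloor>r / \<tau>\<rfloor>) * \<tau> \<le> r" "r < real (nat \<lfloor>r / \<tau>\<rfloor>) * \<tau> + \<tau>"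
proof -
  have "real (nat \<lfloor>r / \<tau>\<rfloor>) \<le> r / \<tau>" "r / \<tau> < real (nat \<lfloor>r / \<tau>\<rfloor>) + 1"
    using assms by (auto intro: of_nat_floor)
  then show "real (nat \<lfloor>r / \<tau>\<rfloor>) * \<tau> \<le> r" "r < real (nat \<lfloor>r / \<tau>\<rfloor>) * \<tau> + \<tau>"
    using assms(1) by (auto simp: field_simps)
qed

lemma eventually_at_right_0_I:
  "d > 0 \<Longrightarrow> (\<And>h. 0 < h \<Longrightarrow> h < d \<Longrightarrow> P h) \<Longrightarrow> eventually P (at_right (0::real))"
  unfolding eventually_at_right_field by auto

subsection \<open>Stable consistent families\<close>

text \<open>The product structure of \<open>V\<close> is forgotten; stability and consistency with a
  linear, densely defined graph remain. The exponent is non-negative so that the bounds grow with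
  time.\<close>

locale chernoff_family =
  fixes V :: "real \<Rightarrow> 'a::banach \<Rightarrow>\<^sub>L 'a" and G :: "('a \<times> 'a) set" and M a :: real
  assumes M_ge_1: "M \<ge> 1" and a_nonneg: "a \<ge> 0"
    and stable: "\<tau> > 0 \<Longrightarrow> norm ((blinfun_apply (V \<tau>) ^^ m) x) \<le> M * exp (a * (real m * \<tau>)) * norm x"
    and consistent: "(x, y) \<in> G \<Longrightarrow> ((\<lambda>\<tau>. (V \<tau> x - x) /\<^sub>R \<tau>) \<longlongrightarrow> y) (at_right 0)"
    and subspace_G: "subspace G"
    and dense_Domain: "closure (Domain G) = UNIV"
begin

definition W :: "real \<Rightarrow> real \<Rightarrow> 'a \<Rightarrow> 'a" where
  "W \<tau> r = blinfun_apply (V \<tau>) ^^ nat \<lfloor>r / \<tau>\<rfloor>"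

definition K :: "real \<Rightarrow> real" where
  "K R = M * exp (a * R)"

lemma K_ge_1: "R \<ge> 0 \<Longrightarrow> K R \<ge> 1"
  unfolding K_def using M_ge_1 a_nonneg
  by (metis mult.right_neutral mult_mono one_le_exp_iff mult_nonneg_nonneg order_trans zero_le_one)

lemma K_pos: "K R > 0"
  unfolding K_def using M_ge_1 by simp

lemma K_mono: "r \<le> R \<Longrightarrow> K r \<le> K R"
  unfolding K_def using M_ge_1 a_nonneg by (simp add: mult_left_mono)

lemma power_bound:
  assumes "\<tau> > 0" "real m * \<tau> \<le> R"
  shows "norm ((blinfun_apply (V \<tau>) ^^ m) x) \<le> K R * norm x"
proof -
  have "norm ((blinfun_apply (V \<tau>) ^^ m) x) \<le> K (real m * \<tau>) * norm x"
    using stable[OF assms(1)] by (simp add: K_def)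
  also have "\<dots> \<le> K R * norm x" using assms(2) by (intro mult_right_mono K_mono) auto
  finally show ?thesis .
qed

lemma W_bound: "\<tau> > 0 \<Longrightarrow> 0 \<le> r \<Longrightarrow> r \<le> R \<Longrightarrow> norm (W \<tau> r x) \<le> K R * norm x"
  unfolding W_def using nat_floor_mult_le(1)[of \<tau> r] by (intro power_bound) auto

lemma W_0 [simp]: "W \<tau> 0 x = x"
  by (simp add: W_def)

lemmas W_add = funpow_blinfun_add[where A = "V \<tau>" and m = "nat \<lfloor>r / \<tau>\<rfloor>" for \<tau> r, folded W_def]
lemmas W_diff = funpow_blinfun_diff[where A = "V \<tau>" and m = "nat \<lfloor>r / \<tau>\<rfloor>" for \<tau> r, folded W_def]
lemmas W_scaleR = funpow_blinfun_scaleR[where A = "V \<tau>" and m = "nat \<lfloor>r / \<tau>\<rfloor>" for \<tau> r, folded W_def]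

text \<open>Telescoping gives \<open>m - l\<close> increments of norm at most
  \<open>K R * (L * \<tau>)\<close>, so the elapsed time \<open>(m - l) * \<tau>\<close> controls
  the difference. Stating this for powers instead of times makes it cover rounding errors
  too.\<close>

lemma equicontinuous_power_Domain:
  assumes xy: "(x, y) \<in> G" and e: "e > 0"
  obtains d where "d > 0"
    "\<And>\<tau> l m. 0 < \<tau> \<Longrightarrow> \<tau> < d \<Longrightarrow> l \<le> m \<Longrightarrow> real m * \<tau> \<le> R \<Longrightarrow> real (m - l) * \<tau> < d \<Longrightarrow>
      norm ((blinfun_apply (V \<tau>) ^^ m) x - (blinfun_apply (V \<tau>) ^^ l) x) \<le> e"
proof -
  from tendstoD[OF consistent[OF xy], of 1] obtain d0 where "d0 > 0"
    and d0: "\<And>\<tau>. 0 < \<tau> \<Longrightarrow> \<tau> < d0 \<Longrightarrow> dist ((V \<tau> x - x) /\<^sub>R \<tau>) y < 1"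
    by (rule eventually_at_right_0_D) (auto simp: dist_norm)
  \<comment> \<open>The difference quotients converge to \<open>y\<close>, so
    \<open>norm y + 1\<close> bounds them for all small \<open>\<tau>\<close>.\<close>
  define L where "L = norm y + 1"
  have L: "L > 0" by (simp add: L_def add_nonneg_pos)
  have V: "norm (V \<tau> x - x) \<le> L * \<tau>" if "0 < \<tau>" "\<tau> < d0" for \<tau>
  proof -
    have "norm ((V \<tau> x - x) /\<^sub>R \<tau>) \<le> L"
      using d0[OF that] norm_triangle_ineq2[of "(V \<tau> x - x) /\<^sub>R \<tau>" y]
      by (simp add: L_def dist_norm)
    moreover have "norm ((V \<tau> x - x) /\<^sub>R \<tau>) = norm (V \<tau> x - x) / \<tau>"
      using that by (simp add: divide_inverse mult.commute)
    ultimately show ?thesis using that by (simp add: pos_divide_le_eq)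
  qed
  define d where "d = min d0 (e / (K R * L))"
  show ?thesis
  proof
    show "d > 0" using \<open>d0 > 0\<close> e K_pos[of R] L by (simp add: d_def)
    fix \<tau> :: real and l m :: nat
    assume *: "0 < \<tau>" "\<tau> < d" "l \<le> m" "real m * \<tau> \<le> R" "real (m - l) * \<tau> < d"
    have "norm (\<Sum>k=l..<m. (blinfun_apply (V \<tau>) ^^ k) (V \<tau> x - x)) \<le> real (m - l) * (K R * (L * \<tau>))"
    proof (rule norm_sum_atLeastLessThan_le)
      fix k assume k: "l \<le> k" "k < m"
      have "real k * \<tau> \<le> R" using k * by (smt (verit) mult_right_mono of_nat_less_iff)
      then have "norm ((blinfun_apply (V \<tau>) ^^ k) (V \<tau> x - x)) \<le> K R * norm (V \<tau> x - x)"
        using * by (intro power_bound) auto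
      also have "\<dots> \<le> K R * (L * \<tau>)"
        using V[of \<tau>] * K_pos[of R] by (intro mult_left_mono) (auto simp: d_def)
      finally show "norm ((blinfun_apply (V \<tau>) ^^ k) (V \<tau> x - x)) \<le> K R * (L * \<tau>)" .
    qed
    also have "\<dots> = (real (m - l) * \<tau>) * (K R * L)" by (simp add: algebra_simps)
    also have "\<dots> \<le> d * (K R * L)" using * K_pos[of R] L by (intro mult_right_mono) auto
    also have "\<dots> \<le> e / (K R * L) * (K R * L)"
      using K_pos[of R] L by (intro mult_right_mono) (auto simp: d_def)
    also have "\<dots> = e" using K_pos[of R] L by simp
    finally show "norm ((blinfun_apply (V \<tau>) ^^ m) x - (blinfun_apply (V \<tau>) ^^ l) x) \<le> e"
      using funpow_blinfun_telescope[OF \<open>l \<le> m\<close>] by metis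
  qed
qed

text \<open>By stability the powers up to time \<open>R\<close> share the Lipschitz constant
  \<open>K R\<close>, so the estimate extends from the dense domain at the price of thirds of
  \<open>e\<close>.\<close>

lemma equicontinuous_power:
  assumes e: "e > 0"
  obtains d where "d > 0"
    "\<And>\<tau> l m. 0 < \<tau> \<Longrightarrow> \<tau> < d \<Longrightarrow> l \<le> m \<Longrightarrow> real m * \<tau> \<le> R \<Longrightarrow> real (m - l) * \<tau> < d \<Longrightarrow>
      norm ((blinfun_apply (V \<tau>) ^^ m) x - (blinfun_apply (V \<tau>) ^^ l) x) \<le> e"
proof -
  have "x \<in> closure (Domain G)" by (simp add: dense_Domain)
  moreover have "e / (3 * K R) > 0" using e K_pos[of R] by simp
  ultimately obtain x' where "x' \<in> Domain G" and x': "dist x' x < e / (3 * K R)"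
    unfolding closure_approachable by blast
  then obtain y' where "(x', y') \<in> G" by auto
  moreover have "e / 3 > 0" using e by simp
  ultimately obtain d where "d > 0" and d:
    "\<And>\<tau> l m. 0 < \<tau> \<Longrightarrow> \<tau> < d \<Longrightarrow> l \<le> m \<Longrightarrow> real m * \<tau> \<le> R \<Longrightarrow> real (m - l) * \<tau> < d \<Longrightarrow>
      norm ((blinfun_apply (V \<tau>) ^^ m) x' - (blinfun_apply (V \<tau>) ^^ l) x') \<le> e / 3"
    using equicontinuous_power_Domain[of x' y' "e / 3" R] by blast
  have near: "norm ((blinfun_apply (V \<tau>) ^^ k) x - (blinfun_apply (V \<tau>) ^^ k) x') \<le> e / 3"
    if "0 < \<tau>" "real k * \<tau> \<le> R" for \<tau> k
  proof -
    have "norm ((blinfun_apply (V \<tau>) ^^ k) (x - x')) \<le> K R * norm (x - x')"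
      using that by (rule power_bound)
    also have "\<dots> \<le> K R * (e / (3 * K R))"
      using x' K_pos[of R] by (intro mult_left_mono) (auto simp: dist_norm norm_minus_commute)
    also have "\<dots> = e / 3" using K_pos[of R] by simp
    finally show ?thesis by (simp add: funpow_blinfun_diff)
  qed
  show ?thesis
  proof (rule that[OF \<open>d > 0\<close>])
    fix \<tau> :: real and l m :: nat
    assume *: "0 < \<tau>" "\<tau> < d" "l \<le> m" "real m * \<tau> \<le> R" "real (m - l) * \<tau> < d"
    have l: "real l * \<tau> \<le> R" using * by (smt (verit) mult_right_mono of_nat_le_iff)
    let ?P = "\<lambda>k. blinfun_apply (V \<tau>) ^^ k"
    have "?P m x - ?P l x = (?P m x - ?P m x') + (?P m x' - ?P l x') - (?P l x - ?P l x')"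
      by simp
    also have "norm \<dots> \<le> norm (?P m x - ?P m x') + norm (?P m x' - ?P l x') + norm (?P l x - ?P l x')"
      by (smt (verit) norm_triangle_ineq norm_triangle_ineq4)
    also have "\<dots> \<le> e" using near[of \<tau> m] near[of \<tau> l] d[OF *] * l by simp
    finally show "norm (?P m x - ?P l x) \<le> e" .
  qed
qed

lemma W_uniformly_equicontinuous:
  assumes e: "e > 0"
  obtains d where "d > 0"
    "\<And>\<tau> s r. 0 < \<tau> \<Longrightarrow> \<tau> < d \<Longrightarrow> 0 \<le> s \<Longrightarrow> s \<le> r \<Longrightarrow> r \<le> R \<Longrightarrow> r - s < d \<Longrightarrow>
      norm (W \<tau> r x - W \<tau> s x) \<le> e"
proof -
  obtain d where "d > 0" and d:
    "\<And>\<tau> l m. 0 < \<tau> \<Longrightarrow> \<tau> < d \<Longrightarrow> l \<le> m \<Longrightarrow> real m * \<tau> \<le> R \<Longrightarrow> real (m - l) * \<tau> < d \<Longrightarrow>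
      norm ((blinfun_apply (V \<tau>) ^^ m) x - (blinfun_apply (V \<tau>) ^^ l) x) \<le> e"
    using equicontinuous_power[OF e] by blast
  show ?thesis
  proof
    \<comment> \<open>Half of \<open>d\<close> is reserved for rounding: the grid time between the
      two powers exceeds \<open>r - s\<close> by less than \<open>\<tau>\<close>.\<close>
    show "d / 2 > 0" using \<open>d > 0\<close> by simp
    fix \<tau> s r assume *: "0 < \<tau>" "\<tau> < d / 2" "0 \<le> s" "s \<le> r" "r \<le> R" "r - s < d / 2"
    define m where "m = nat \<lfloor>r / \<tau>\<rfloor>"
    define l where "l = nat \<lfloor>s / \<tau>\<rfloor>"
    have lm: "l \<le> m"
      unfolding l_def m_def using * by (intro nat_mono floor_mono divide_right_mono) auto
    have m: "real m * \<tau> \<le> r" "s < real l * \<tau> + \<tau>"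
      using nat_floor_mult_le(1)[of \<tau> r] nat_floor_mult_le(2)[of \<tau> s] * by (auto simp: m_def l_def)
    then have "real (m - l) * \<tau> < d" using lm * by (simp add: of_nat_diff left_diff_distrib)
    with d[of \<tau> l m] m lm * show "norm (W \<tau> r x - W \<tau> s x) \<le> e" by (simp add: W_def m_def l_def)
  qed
qed

text \<open>Rounding \<open>s / \<tau>\<close> and \<open>h / \<tau>\<close> down separately loses
  at most one step against rounding their sum, and equicontinuity makes a single step
  negligible.\<close>

lemma W_compose_tendsto:
  assumes "s \<ge> 0" "h \<ge> 0"
  shows "((\<lambda>\<tau>. W \<tau> (s + h) x - W \<tau> s (W \<tau> h x)) \<longlongrightarrow> 0) (at_right 0)"
proof (rule tendstoI)
  fix e :: real assume "e > 0"
  then have e2: "e / 2 > 0" by simp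
  obtain d where "d > 0" and d:
    "\<And>\<tau> l m. 0 < \<tau> \<Longrightarrow> \<tau> < d \<Longrightarrow> l \<le> m \<Longrightarrow> real m * \<tau> \<le> s + h \<Longrightarrow> real (m - l) * \<tau> < d \<Longrightarrow>
      norm ((blinfun_apply (V \<tau>) ^^ m) x - (blinfun_apply (V \<tau>) ^^ l) x) \<le> e / 2"
    using equicontinuous_power[OF e2] by blast
  have "dist (W \<tau> (s + h) x - W \<tau> s (W \<tau> h x)) 0 < e" if \<tau>: "0 < \<tau>" "\<tau> < d" for \<tau>
  proof -
    define m where "m = nat \<lfloor>(s + h) / \<tau>\<rfloor>"
    define l where "l = nat \<lfloor>s / \<tau>\<rfloor> + nat \<lfloor>h / \<tau>\<rfloor>"
    have nn: "s / \<tau> \<ge> 0" "h / \<tau> \<ge> 0" using assms \<tau> by auto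
    have sum: "(s + h) / \<tau> = s / \<tau> + h / \<tau>" by (simp add: add_divide_distrib)
    have "\<lfloor>s / \<tau>\<rfloor> + \<lfloor>h / \<tau>\<rfloor> \<le> \<lfloor>(s + h) / \<tau>\<rfloor>" "\<lfloor>(s + h) / \<tau>\<rfloor> \<le> \<lfloor>s / \<tau>\<rfloor> + \<lfloor>h / \<tau>\<rfloor> + 1"
      unfolding sum by linarith+
    moreover have "\<lfloor>s / \<tau>\<rfloor> \<ge> 0" "\<lfloor>h / \<tau>\<rfloor> \<ge> 0" using nn by auto
    ultimately have lm: "l \<le> m" "m \<le> l + 1" unfolding l_def m_def by linarith+
    have m: "real m * \<tau> \<le> s + h"
      using nat_floor_mult_le(1)[of \<tau> "s + h"] assms \<tau> by (simp add: m_def)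
    have "real (m - l) \<le> 1" using lm by linarith
    then have "real (m - l) * \<tau> \<le> 1 * \<tau>" using \<tau> by (intro mult_right_mono) auto
    then have "real (m - l) * \<tau> < d" using \<tau> by linarith
    with \<tau> lm(1) m have "norm ((blinfun_apply (V \<tau>) ^^ m) x - (blinfun_apply (V \<tau>) ^^ l) x) \<le> e / 2"
      by (intro d)
    then show ?thesis using \<open>e > 0\<close> by (simp add: W_def m_def l_def funpow_add)
  qed
  with \<open>d > 0\<close> show "\<forall>\<^sub>F \<tau> in at_right 0. dist (W \<tau> (s + h) x - W \<tau> s (W \<tau> h x)) 0 < e"
    by (rule eventually_at_right_0_I)
qed

text \<open>
  The length of the admissible time interval depends only on \<open>y0\<close>, hence is uniform over nearby
  values of the generator; this is what makes the estimate survive the passage to the closure.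
\<close>
lemma first_order_estimate:
  assumes e: "e > 0"
  obtains d where "d > 0"
    "\<And>x y h. (x, y) \<in> closure G \<Longrightarrow> norm (y - y0) < d \<Longrightarrow> 0 < h \<Longrightarrow> h < d \<Longrightarrow>
      \<forall>\<^sub>F \<tau> in at_right 0. norm (W \<tau> h x - x - h *\<^sub>R y) \<le> e * h"
proof -
  define K1 where "K1 = K 1"
  have K1: "K1 \<ge> 1" using K_ge_1[of 1] by (simp add: K1_def)
  have e4: "e / 4 > 0" using e by simp
  obtain d3 where "d3 > 0" and d3:
    "\<And>\<tau> l m. 0 < \<tau> \<Longrightarrow> \<tau> < d3 \<Longrightarrow> l \<le> m \<Longrightarrow> real m * \<tau> \<le> 1 \<Longrightarrow> real (m - l) * \<tau> < d3 \<Longrightarrow>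
      norm ((blinfun_apply (V \<tau>) ^^ m) y0 - (blinfun_apply (V \<tau>) ^^ l) y0) \<le> e / 4"
    using equicontinuous_power[OF e4] by blast
  \<comment> \<open>The bound 1 lets \<open>K 1\<close> serve for all powers, \<open>d3\<close>
    keeps the powers at \<open>y0\<close> nearly constant, and the last term pays for replacing
    \<open>g\<close> by \<open>y0\<close>. None of them depends on \<open>x\<close>,
    \<open>y\<close> or \<open>h\<close>.\<close>
  define d where "d = min (min 1 d3) (e / (8 * (K1 + 1)))"
  have d: "d > 0" "d \<le> 1" "d \<le> d3" "d \<le> e / (8 * (K1 + 1))"
    using \<open>d3 > 0\<close> e K1 by (auto simp: d_def)
  have dK: "2 * d * (K1 + 1) \<le> e / 4" using d(4) K1 by (simp add: field_simps)
  show ?thesis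
  proof (rule that[OF d(1)])
    fix x y h assume xy: "(x, y) \<in> closure G" and yd: "norm (y - y0) < d" and h: "0 < h" "h < d"
    \<comment> \<open>The approximant \<open>(f, g)\<close> may depend on \<open>h\<close>, and
      must: the error \<open>x - f\<close> is not multiplied by \<open>h\<close>, so it has to be of
      order \<open>e * h\<close> itself. The bound by \<open>d\<close> keeps \<open>g\<close> within
      \<open>2 * d\<close> of \<open>y0\<close>.\<close>
    define b where "b = min d (min (e * h / (8 * (K1 + 1))) (e / 8))"
    have b: "b > 0" using d e h K1 by (simp add: b_def)
    obtain f g where fg: "(f, g) \<in> G" "dist (f, g) (x, y) < b"
      using xy b unfolding closure_approachable by (metis surj_pair)
    have fx: "norm (x - f) < b" and gy: "norm (g - y) < b"
      using fg(2) dist_fst_le[of "(f, g)" "(x, y)"] dist_snd_le[of "(f, g)" "(x, y)"]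
      by (auto simp: dist_norm norm_minus_commute)
    have gy0: "norm (g - y0) \<le> 2 * d"
      using norm_triangle_ineq[of "g - y" "y - y0"] gy yd by (simp add: b_def)
    have e8: "e / (8 * K1) > 0" using e K1 by simp
    have ev1: "\<forall>\<^sub>F \<tau> in at_right 0. dist ((V \<tau> f - f) /\<^sub>R \<tau>) g < e / (8 * K1)"
      by (rule tendstoD[OF consistent[OF fg(1)] e8])
    define c where "c = norm g + 1"
    have c: "c > 0" "norm g \<le> c" by (auto simp: c_def add_nonneg_pos)
    have "\<forall>\<^sub>F \<tau> in at_right 0. 0 < \<tau> \<and> \<tau> < d3 \<and> \<tau> * norm g \<le> e * h / 8"
    proof (rule eventually_at_right_0_I)
      show "min d3 (e * h / (8 * c)) > 0" using \<open>d3 > 0\<close> e h c by simp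
      fix \<tau> assume \<tau>: "0 < \<tau>" "\<tau> < min d3 (e * h / (8 * c))"
      have "\<tau> * norm g \<le> e * h / (8 * c) * c"
        using \<tau> c by (intro mult_mono) auto
      also have "\<dots> = e * h / 8" using c by simp
      finally show "0 < \<tau> \<and> \<tau> < d3 \<and> \<tau> * norm g \<le> e * h / 8" using \<tau> by auto
    qed
    with ev1 show "\<forall>\<^sub>F \<tau> in at_right 0. norm (W \<tau> h x - x - h *\<^sub>R y) \<le> e * h"
    proof eventually_elim
      case (elim \<tau>)
      then have \<tau>: "\<tau> > 0" "\<tau> < d3" and \<tau>g: "\<tau> * norm g \<le> e * h / 8" by auto
      let ?P = "\<lambda>k. blinfun_apply (V \<tau>) ^^ k"
      define m where "m = nat \<lfloor>h / \<tau>\<rfloor>"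
      have m: "real m * \<tau> \<le> h" "h < real m * \<tau> + \<tau>"
        using nat_floor_mult_le[of \<tau> h] \<tau> h by (auto simp: m_def)
      define q where "q = (V \<tau> f - f) /\<^sub>R \<tau>"
      have q: "norm (q - g) \<le> e / (8 * K1)" using elim by (simp add: q_def dist_norm)
      have Vf: "V \<tau> f - f = \<tau> *\<^sub>R q" using \<tau> by (simp add: q_def)
      have Pk: "norm (?P k z) \<le> K1 * norm z" if "k < m" for k z
      proof -
        have "real k * \<tau> \<le> 1"
          using that m(1) \<tau> h d(2) by (smt (verit) mult_right_mono of_nat_less_iff)
        then show ?thesis using \<tau>(1) unfolding K1_def by (intro power_bound)
      qed
      have summand: "norm (?P k (V \<tau> f - f) - \<tau> *\<^sub>R g) \<le> \<tau> * (5 * e / 8)" if k: "k < m" for k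
      proof -
        have "real k * \<tau> \<le> real m * \<tau>" using k \<tau> by (intro mult_right_mono) auto
        then have kt: "real k * \<tau> < d" using m h by linarith
        have 1: "norm (?P k y0 - ?P 0 y0) \<le> e / 4"
          using kt d \<tau> by (intro d3) auto
        have 2: "norm (?P k (g - y0)) \<le> K1 * (2 * d)"
          using Pk[OF k, of "g - y0"] gy0 K1 by (smt (verit) mult_left_mono)
        have 3: "norm (?P k (q - g)) \<le> e / 8"
        proof -
          have "norm (?P k (q - g)) \<le> K1 * (e / (8 * K1))"
            using Pk[OF k, of "q - g"] q K1 by (smt (verit) mult_left_mono)
          then show ?thesis using K1 by simp
        qed
        \<comment> \<open>The detour through \<open>y0\<close> confines equicontinuity to that one
          vector; the other terms are small by the sizes of \<open>q - g\<close> and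
          \<open>g - y0\<close>.\<close>
        have "?P k q - g = ?P k (q - g) + ?P k (g - y0) + (?P k y0 - ?P 0 y0) - (g - y0)"
          by (simp add: funpow_blinfun_diff)
        then have "norm (?P k q - g) \<le>
            norm (?P k (q - g)) + norm (?P k (g - y0)) + norm (?P k y0 - ?P 0 y0) + norm (g - y0)"
          by (smt (verit) norm_triangle_ineq norm_triangle_ineq4)
        also have "\<dots> \<le> e / 8 + K1 * (2 * d) + e / 4 + 2 * d" using 1 2 3 gy0 by simp
        also have "\<dots> \<le> 5 * e / 8" using dK by (simp add: algebra_simps)
        finally have "norm (?P k q - g) \<le> 5 * e / 8" .
        then have "\<tau> * norm (?P k q - g) \<le> \<tau> * (5 * e / 8)" using \<tau> by (intro mult_left_mono) auto
        then show ?thesis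
          using \<tau> by (simp add: Vf funpow_blinfun_scaleR flip: scaleR_right_diff_distrib)
      qed
      have A: "norm (?P m f - f - (real m * \<tau>) *\<^sub>R g) \<le> 5 * e * h / 8"
      proof -
        have "?P m f - f - (real m * \<tau>) *\<^sub>R g = (\<Sum>k=0..<m. ?P k (V \<tau> f - f) - \<tau> *\<^sub>R g)"
          using funpow_blinfun_telescope[of 0 m "V \<tau>" f]
          by (simp add: sum_subtractf sum_constant_scaleR)
        also have "norm \<dots> \<le> real (m - 0) * (\<tau> * (5 * e / 8))"
          using summand by (intro norm_sum_atLeastLessThan_le) auto
        also have "\<dots> = (real m * \<tau>) * (5 * e / 8)" by simp
        also have "\<dots> \<le> h * (5 * e / 8)" using m e by (intro mult_right_mono) auto
        finally show ?thesis by (simp add: mult.commute)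
      qed
      have B: "norm ((real m * \<tau> - h) *\<^sub>R g) \<le> e * h / 8"
      proof -
        have "norm ((real m * \<tau> - h) *\<^sub>R g) \<le> \<tau> * norm g"
          using m by (auto intro!: mult_right_mono)
        then show ?thesis using \<tau>g by simp
      qed
      have C: "norm (?P m (x - f) - (x - f)) \<le> e * h / 8"
      proof -
        have "norm (?P m (x - f)) \<le> K1 * norm (x - f)"
          unfolding K1_def using \<tau> m h d by (intro power_bound) auto
        then have "norm (?P m (x - f) - (x - f)) \<le> (K1 + 1) * norm (x - f)"
          using norm_triangle_ineq4[of "?P m (x - f)" "x - f"] by (simp add: algebra_simps)
        also have "\<dots> \<le> (K1 + 1) * (e * h / (8 * (K1 + 1)))"
          using fx K1 by (intro mult_left_mono) (auto simp: b_def)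
        also have "\<dots> = e * h / 8" using K1 by (simp add: divide_simps)
        finally show ?thesis .
      qed
      have D: "norm (h *\<^sub>R (g - y)) \<le> e * h / 8"
        using gy h by (simp add: b_def)
      \<comment> \<open>The budget of eighths of \<open>e * h\<close>: five for the telescoping sum
        and one each for rounding \<open>h\<close>, replacing \<open>x\<close> by \<open>f\<close>,
        and replacing \<open>y\<close> by \<open>g\<close>.\<close>
      have "W \<tau> h x - x - h *\<^sub>R y = (?P m f - f - (real m * \<tau>) *\<^sub>R g) + (real m * \<tau> - h) *\<^sub>R g
          + (?P m (x - f) - (x - f)) + h *\<^sub>R (g - y)"
        by (simp add: W_def m_def funpow_blinfun_diff algebra_simps)
      also have "norm \<dots> \<le> norm (?P m f - f - (real m * \<tau>) *\<^sub>R g) + norm ((real m * \<tau> - h) *\<^sub>R g)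
          + norm (?P m (x - f) - (x - f)) + norm (h *\<^sub>R (g - y))"
        by (smt (verit) norm_triangle_ineq)
      also have "\<dots> \<le> e * h" using A B C D by simp
      finally show ?case .
    qed
  qed
qed

end

lemma subspace_closure:
  fixes N :: "'a::real_normed_vector set"
  assumes "subspace N"
  shows "subspace (closure N)"
proof (rule subspaceI)
  show "0 \<in> closure N" using subspace_0[OF assms] closure_subset by blast
next
  fix x y assume "x \<in> closure N" "y \<in> closure N"
  then obtain f g where "\<And>n. f n \<in> N" "f \<longlonglongrightarrow> x" "\<And>n. g n \<in> N" "g \<longlonglongrightarrow> y"
    unfolding closure_sequential by blast
  then show "x + y \<in> closure N"
    unfolding closure_sequential
    by (intro exI[of _ "\<lambda>n. f n + g n"]) (auto intro: subspace_add[OF assms] tendsto_add)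
next
  fix c x assume "x \<in> closure N"
  then obtain f where "\<And>n. f n \<in> N" "f \<longlonglongrightarrow> x"
    unfolding closure_sequential by blast
  then show "c *\<^sub>R x \<in> closure N"
    unfolding closure_sequential
    by (intro exI[of _ "\<lambda>n. c *\<^sub>R f n"]) (auto intro: subspace_scale[OF assms] tendsto_intros)
qed

context chernoff_family
begin

text \<open>Applying \<open>W \<tau> s\<close> to the estimate at time 0 costs a factor
  \<open>K R\<close>, whence \<open>e / (2 * K R)\<close>. The other half of the error absorbs the
  defect in the semigroup law, which vanishes with \<open>\<tau>\<close> for fixed \<open>s\<close>
  and \<open>h\<close>.\<close>

lemma first_order_estimate_shifted:
  assumes e: "e > 0"
  obtains d where "d > 0"
    "\<And>x y s h. (x, y) \<in> closure G \<Longrightarrow> norm (y - y0) < d \<Longrightarrow> 0 \<le> s \<Longrightarrow> s \<le> R \<Longrightarrow> 0 < h \<Longrightarrow> h < d \<Longrightarrow>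
      \<forall>\<^sub>F \<tau> in at_right 0. norm (W \<tau> (s + h) x - W \<tau> s x - h *\<^sub>R W \<tau> s y) \<le> e * h"
proof -
  have "e / (2 * K R) > 0" using e K_pos[of R] by simp
  then obtain d where "d > 0" and d:
    "\<And>x y h. (x, y) \<in> closure G \<Longrightarrow> norm (y - y0) < d \<Longrightarrow> 0 < h \<Longrightarrow> h < d \<Longrightarrow>
      \<forall>\<^sub>F \<tau> in at_right 0. norm (W \<tau> h x - x - h *\<^sub>R y) \<le> e / (2 * K R) * h"
    using first_order_estimate[where e = "e / (2 * K R)" and ?y0.0 = y0] by blast
  show ?thesis
  proof (rule that[OF \<open>d > 0\<close>])
    fix x y s h
    assume xy: "(x, y) \<in> closure G" "norm (y - y0) < d" and s: "0 \<le> s" "s \<le> R" and h: "0 < h" "h < d"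
    have eh: "e * h / 2 > 0" using e h by simp
    have "\<forall>\<^sub>F \<tau> in at_right 0. dist (W \<tau> (s + h) x - W \<tau> s (W \<tau> h x)) 0 < e * h / 2"
      using W_compose_tendsto[of s h x] s h eh by (intro tendstoD) auto
    moreover have "\<forall>\<^sub>F \<tau> in at_right (0::real). \<tau> > 0" by (rule eventually_at_right_less)
    ultimately show "\<forall>\<^sub>F \<tau> in at_right 0. norm (W \<tau> (s + h) x - W \<tau> s x - h *\<^sub>R W \<tau> s y) \<le> e * h"
      using d[OF xy h]
    proof eventually_elim
      case (elim \<tau>)
      have "norm (W \<tau> s (W \<tau> h x - x - h *\<^sub>R y)) \<le> K R * norm (W \<tau> h x - x - h *\<^sub>R y)"
        using elim(2) s by (intro W_bound)
      also have "\<dots> \<le> K R * (e / (2 * K R) * h)"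
        using elim(3) K_pos[of R] by (intro mult_left_mono) auto
      also have "\<dots> = e * h / 2" using K_pos[of R] by simp
      finally have A: "norm (W \<tau> s (W \<tau> h x - x - h *\<^sub>R y)) \<le> e * h / 2" .
      have "W \<tau> (s + h) x - W \<tau> s x - h *\<^sub>R W \<tau> s y =
          (W \<tau> (s + h) x - W \<tau> s (W \<tau> h x)) + W \<tau> s (W \<tau> h x - x - h *\<^sub>R y)"
        by (simp add: W_diff W_scaleR)
      also have "norm \<dots> \<le> e * h / 2 + e * h / 2"
        using A elim(1) by (intro norm_triangle_mono) auto
      finally show ?case by simp
    qed
  qed
qed

lemma subspace_closure_G: "subspace (closure G)"
  using subspace_G by (rule subspace_closure)

text \<open>At \<open>x = 0\<close> the first-order estimate reads
  \<open>h * norm y \<le> e * h\<close> with arbitrary \<open>e\<close>; linearity of the closure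
  reduces single-valuedness to this case.\<close>

lemma closable_G: "closable G"
proof -
  have zero: "y = 0" if y: "(0, y) \<in> closure G" for y
  proof -
    have "norm y \<le> e" if e: "e > 0" for e
    proof -
      obtain d where "d > 0" and d:
        "\<And>x z h. (x, z) \<in> closure G \<Longrightarrow> norm (z - y) < d \<Longrightarrow> 0 < h \<Longrightarrow> h < d \<Longrightarrow>
          \<forall>\<^sub>F \<tau> in at_right 0. norm (W \<tau> h x - x - h *\<^sub>R z) \<le> e * h"
        using first_order_estimate[OF e, where ?y0.0 = y] by blast
      define h where "h = d / 2"
      have h: "0 < h" "h < d" using \<open>d > 0\<close> by (auto simp: h_def)
      have "W \<tau> h 0 = 0" for \<tau> using W_scaleR[of \<tau> h 0 0] by simp
      then have "\<forall>\<^sub>F \<tau> in at_right (0::real). h * norm y \<le> e * h"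
        using d[OF y _ h] \<open>d > 0\<close> h by simp
      then have "h * norm y \<le> e * h" by (simp add: eventually_const_iff)
      then show ?thesis using h by simp
    qed
    then show ?thesis using field_le_epsilon[of "norm y" 0] by simp
  qed
  show ?thesis
    unfolding closable_def
  proof (rule single_valuedI)
    fix x y z assume "(x, y) \<in> closure G" "(x, z) \<in> closure G"
    then have "(x, y) - (x, z) \<in> closure G" by (intro subspace_diff subspace_closure_G)
    then have "y - z = 0" by (intro zero) simp
    then show "y = z" by simp
  qed
qed

subsection \<open>Chernoff's product formula and generation\<close>

text \<open>The powers are compared with one solution at a time. No semigroup generated by
  \<open>closure G\<close> is presupposed, so the result can also be used to construct one.\<close>

theorem classical_solution_limit:
  assumes sol: "classical_solution (closure G) u w" and r: "r \<ge> 0"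
  shows "((\<lambda>\<tau>. W \<tau> r (u 0)) \<longlongrightarrow> u r) (at_right 0)"
proof -
  have G: "\<And>s. s \<ge> 0 \<Longrightarrow> (u s, w s) \<in> closure G" and w: "continuous_on {0..} w"
    and diff: "\<And>R e. e > 0 \<Longrightarrow> \<exists>d>0. \<forall>s h. 0 \<le> s \<and> s \<le> R \<and> 0 < h \<and> h < d \<longrightarrow>
        norm (u (s + h) - u s - h *\<^sub>R w s) \<le> e * h"
    using sol by (auto simp: classical_solution_def)
  text \<open>The map \<open>s \<mapsto> W \<tau> (r - s) (u s)\<close> interpolates between the two sides and is nearly constant.\<close>
  have interp: "\<forall>\<^sub>F \<tau> in at_right 0. norm (W \<tau> (r - r) (u r) - W \<tau> (r - 0) (u 0)) \<le> e * (r - 0) + \<eta>"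
    if e: "e > 0" and \<eta>: "\<eta> > 0" for e \<eta>
  proof -
    \<comment> \<open>The error \<open>e * (s2 - s1)\<close> adds up over adjacent intervals. The
      slack \<open>\<eta>\<close> absorbs what merely tends to 0 with \<open>\<tau>\<close>; being
      arbitrary, it can be halved whenever two intervals are joined.\<close>
    define Q where "Q s1 s2 \<longleftrightarrow> (0 \<le> s1 \<and> s2 \<le> r \<longrightarrow> (\<forall>\<eta>>0. \<forall>\<^sub>F \<tau> in at_right 0.
        norm (W \<tau> (r - s2) (u s2) - W \<tau> (r - s1) (u s1)) \<le> e * (s2 - s1) + \<eta>))" for s1 s2
    have "Q 0 r"
      using r
    proof (induction rule: Bolzano)
      case (trans s1 s2 s3)
      show ?case
        unfolding Q_def
      proof (intro impI allI)
        fix \<eta> :: real assume s: "0 \<le> s1 \<and> s3 \<le> r" and \<eta>: "\<eta> > 0"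
        then have "\<forall>\<^sub>F \<tau> in at_right 0.
            norm (W \<tau> (r - s2) (u s2) - W \<tau> (r - s1) (u s1)) \<le> e * (s2 - s1) + \<eta> / 2"
          "\<forall>\<^sub>F \<tau> in at_right 0.
            norm (W \<tau> (r - s3) (u s3) - W \<tau> (r - s2) (u s2)) \<le> e * (s3 - s2) + \<eta> / 2"
          using trans unfolding Q_def by auto
        then show "\<forall>\<^sub>F \<tau> in at_right 0.
            norm (W \<tau> (r - s3) (u s3) - W \<tau> (r - s1) (u s1)) \<le> e * (s3 - s1) + \<eta>"
        proof eventually_elim
          case (elim \<tau>)
          have "norm (W \<tau> (r - s3) (u s3) - W \<tau> (r - s1) (u s1)) \<le>
            norm (W \<tau> (r - s3) (u s3) - W \<tau> (r - s2) (u s2)) +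
            norm (W \<tau> (r - s2) (u s2) - W \<tau> (r - s1) (u s1))"
            using norm_triangle_ineq[of "W \<tau> (r - s3) (u s3) - W \<tau> (r - s2) (u s2)"
                "W \<tau> (r - s2) (u s2) - W \<tau> (r - s1) (u s1)"] by simp
          with elim show ?case by (simp add: algebra_simps)
        qed
      qed
    next
      case (local x)
      \<comment> \<open>Solution and powers each deviate from the same linear step by at most
        \<open>e' * h\<close>, and the remaining powers amplify the sum by
        \<open>K r\<close>.\<close>
      define e' where "e' = e / (2 * K r)"
      have e': "e' > 0" "K r * (2 * e') = e" using e K_pos[of r] by (auto simp: e'_def)
      obtain d1 where d1: "d1 > 0"
        "\<And>z y h. (z, y) \<in> closure G \<Longrightarrow> norm (y - w x) < d1 \<Longrightarrow> 0 < h \<Longrightarrow> h < d1 \<Longrightarrow>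
          \<forall>\<^sub>F \<tau> in at_right 0. norm (W \<tau> h z - z - h *\<^sub>R y) \<le> e' * h"
        using first_order_estimate[OF e'(1), where ?y0.0 = "w x"] by blast
      obtain d2 where d2: "d2 > 0" "\<And>s h. 0 \<le> s \<Longrightarrow> s \<le> r \<Longrightarrow> 0 < h \<Longrightarrow> h < d2 \<Longrightarrow>
          norm (u (s + h) - u s - h *\<^sub>R w s) \<le> e' * h"
        using diff[OF e'(1), of r] by auto
      \<comment> \<open>Continuity of \<open>w\<close> puts \<open>w s1\<close> near
        \<open>w x\<close>, so the first-order estimate based at \<open>w x\<close> applies at the
        left endpoint of every short interval around \<open>x\<close>.\<close>
      obtain d3 where d3: "d3 > 0" "\<And>s. s \<ge> 0 \<Longrightarrow> dist s x < d3 \<Longrightarrow> dist (w s) (w x) < d1"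
        using w \<open>0 \<le> x\<close> \<open>d1 > 0\<close> unfolding continuous_on_iff by (metis atLeast_iff)
      have "Q s1 s2" if s12: "s1 \<le> x" "x \<le> s2" "s2 - s1 < min d1 (min d2 d3)" for s1 s2
        unfolding Q_def
      proof (intro impI allI)
        fix \<eta> :: real assume s: "0 \<le> s1 \<and> s2 \<le> r" and \<eta>: "\<eta> > 0"
        define h where "h = s2 - s1"
        show "\<forall>\<^sub>F \<tau> in at_right 0.
            norm (W \<tau> (r - s2) (u s2) - W \<tau> (r - s1) (u s1)) \<le> e * (s2 - s1) + \<eta>"
        proof (cases "h = 0")
          case True
          then show ?thesis using \<eta> by (simp add: h_def)
        next
          case False
          then have h: "0 < h" "h < d1" "h < d2" "h < d3" using s12 by (auto simp: h_def)
          have u1: "(u s1, w s1) \<in> closure G" using G s by auto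
          have w1: "norm (w s1 - w x) < d1"
            using d3(2)[of s1] s s12 by (auto simp: dist_norm)
          have du: "norm (u s2 - u s1 - h *\<^sub>R w s1) \<le> e' * h"
            using d2(2)[of s1 h] s s12 h by (auto simp: h_def)
          have "\<forall>\<^sub>F \<tau> in at_right 0.
              dist (W \<tau> ((r - s2) + h) (u s1) - W \<tau> (r - s2) (W \<tau> h (u s1))) 0 < \<eta>"
            using s h \<eta> by (intro tendstoD W_compose_tendsto) auto
          moreover have "\<forall>\<^sub>F \<tau> in at_right (0::real). \<tau> > 0" by (rule eventually_at_right_less)
          ultimately show ?thesis
            using d1(2)[OF u1 w1 h(1,2)]
          proof eventually_elim
            case (elim \<tau>)
            have "norm (u s2 - W \<tau> h (u s1)) \<le>
                norm (u s2 - u s1 - h *\<^sub>R w s1) + norm (W \<tau> h (u s1) - u s1 - h *\<^sub>R w s1)"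
              using norm_triangle_ineq4[of "u s2 - u s1 - h *\<^sub>R w s1"
                  "W \<tau> h (u s1) - u s1 - h *\<^sub>R w s1"] by simp
            also have "\<dots> \<le> 2 * e' * h" using du elim(3) by simp
            finally have "K r * norm (u s2 - W \<tau> h (u s1)) \<le> K r * (2 * e' * h)"
              using K_pos[of r] by (intro mult_left_mono) auto
            moreover have "norm (W \<tau> (r - s2) (u s2 - W \<tau> h (u s1))) \<le> K r * norm (u s2 - W \<tau> h (u s1))"
              using elim(2) s s12 by (intro W_bound) auto
            ultimately have A: "norm (W \<tau> (r - s2) (u s2 - W \<tau> h (u s1))) \<le> e * h"
              using e'(2) by (simp flip: mult.assoc)
            have "W \<tau> (r - s2) (u s2) - W \<tau> (r - s1) (u s1) = W \<tau> (r - s2) (u s2 - W \<tau> h (u s1))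
                - (W \<tau> ((r - s2) + h) (u s1) - W \<tau> (r - s2) (W \<tau> h (u s1)))"
              by (simp add: W_diff h_def)
            also have "norm \<dots> \<le> e * h + \<eta>"
              using A elim(1) norm_triangle_ineq4 by (smt (verit) dist_norm diff_zero)
            finally show ?case by (simp add: h_def)
          qed
        qed
      qed
      moreover have "min d1 (min d2 d3) > 0" using d1 d2 d3 by simp
      ultimately show ?case by blast
    qed
    then show ?thesis using r \<eta> by (simp add: Q_def)
  qed
  show ?thesis
  proof (rule tendstoI)
    fix e :: real assume e: "e > 0"
    define e' where "e' = e / (2 * (r + 1))"
    have e': "e' > 0" "e' * r \<le> e / 2" using e r by (auto simp: e'_def field_simps)
    have "\<forall>\<^sub>F \<tau> in at_right 0. norm (W \<tau> (r - r) (u r) - W \<tau> (r - 0) (u 0)) \<le> e' * (r - 0) + e / 3"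
      using interp[of e' "e / 3"] e e' by simp
    then show "\<forall>\<^sub>F \<tau> in at_right 0. dist (W \<tau> r (u 0)) (u r) < e"
    proof eventually_elim
      case (elim \<tau>)
      then have "norm (W \<tau> r (u 0) - u r) \<le> e' * r + e / 3" by (simp add: norm_minus_commute)
      then show ?case using e e' by (simp add: dist_norm)
    qed
  qed
qed

section \<open>Convergence from dense sets and the limit semigroup\<close>

lemma W_tendsto_approx:
  assumes r: "r \<ge> 0" and x: "xs \<longlonglongrightarrow> x"
    and l: "\<And>k. ((\<lambda>\<tau>. W \<tau> r (xs k)) \<longlongrightarrow> l k) (at_right 0)" "l \<longlonglongrightarrow> L"
  shows "((\<lambda>\<tau>. W \<tau> r x) \<longlongrightarrow> L) (at_right 0)"
proof (rule tendstoI)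
  fix e :: real assume e: "e > 0"
  then have e': "e / (3 * K r) > 0" "e / 3 > 0" using K_pos[of r] by auto
  obtain N where N: "\<And>k. k \<ge> N \<Longrightarrow> norm (xs k - x) < e / (3 * K r)" using LIMSEQ_D[OF x e'(1)] by auto
  obtain N' where N': "\<And>k. k \<ge> N' \<Longrightarrow> norm (l k - L) < e / 3" using LIMSEQ_D[OF l(2) e'(2)] by auto
  define k where "k = max N N'"
  have k: "norm (xs k - x) < e / (3 * K r)" "norm (l k - L) < e / 3"
    using N[of k] N'[of k] by (auto simp: k_def)
  have "\<forall>\<^sub>F \<tau> in at_right (0::real). \<tau> > 0" by (rule eventually_at_right_less)
  with tendstoD[OF l(1) e'(2), of k] show "\<forall>\<^sub>F \<tau> in at_right 0. dist (W \<tau> r x) L < e"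
  proof eventually_elim
    case (elim \<tau>)
    have "norm (W \<tau> r (xs k - x)) \<le> K r * norm (xs k - x)" using elim r by (intro W_bound) auto
    also have "\<dots> \<le> K r * (e / (3 * K r))" using k K_pos[of r] by (intro mult_left_mono) auto
    also have "\<dots> = e / 3" using K_pos[of r] by simp
    finally have A: "norm (W \<tau> r (xs k - x)) \<le> e / 3" .
    have "W \<tau> r x - L = (W \<tau> r (xs k) - l k) + (l k - L) - W \<tau> r (xs k - x)"
      by (simp add: W_diff)
    then have "norm (W \<tau> r x - L) \<le> norm (W \<tau> r (xs k) - l k) + norm (l k - L) + norm (W \<tau> r (xs k - x))"
      by (smt (verit) norm_triangle_ineq norm_triangle_ineq4)
    then show ?case using A k(2) elim(1) by (simp add: dist_norm)
  qed
qed

lemma W_limit_norm_le: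
  assumes "r \<ge> 0" "((\<lambda>\<tau>. W \<tau> r x) \<longlongrightarrow> l) (at_right 0)"
  shows "norm l \<le> K r * norm x"
proof -
  have "\<forall>\<^sub>F \<tau> in at_right (0::real). \<tau> > 0" by (rule eventually_at_right_less)
  then have "\<forall>\<^sub>F \<tau> in at_right 0. norm (W \<tau> r x) \<le> K r * norm x"
    by eventually_elim (use assms(1) in \<open>auto intro: W_bound\<close>)
  with assms(2) show ?thesis by (intro Lim_norm_ubound[of "at_right 0"]) auto
qed

lemma W_convergent_dense:
  assumes A: "closure A = UNIV" and r: "r \<ge> 0"
    and conv: "\<And>x. x \<in> A \<Longrightarrow> \<exists>l. ((\<lambda>\<tau>. W \<tau> r x) \<longlongrightarrow> l) (at_right 0)"
  shows "\<exists>l. ((\<lambda>\<tau>. W \<tau> r x) \<longlongrightarrow> l) (at_right 0)"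
proof -
  have "x \<in> closure A" by (simp add: A)
  then obtain xs where xs: "\<And>k. xs k \<in> A" "xs \<longlonglongrightarrow> x" unfolding closure_sequential by auto
  obtain l where l: "\<And>k. ((\<lambda>\<tau>. W \<tau> r (xs k)) \<longlongrightarrow> l k) (at_right 0)" using conv[OF xs(1)] by metis
  have diff: "norm (l j - l k) \<le> K r * norm (xs j - xs k)" for j k
    using tendsto_diff[OF l l] by (intro W_limit_norm_le r) (simp add: W_diff)
  have "Cauchy l"
  proof (rule CauchyI)
    fix e :: real assume "e > 0"
    then have "e / K r > 0" using K_pos[of r] by simp
    moreover have "Cauchy xs" using xs(2) by (rule LIMSEQ_imp_Cauchy)
    ultimately obtain N where N: "\<And>m n. m \<ge> N \<Longrightarrow> n \<ge> N \<Longrightarrow> norm (xs m - xs n) < e / K r"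
      using CauchyD by meson
    have "norm (l m - l n) < e" if "m \<ge> N" "n \<ge> N" for m n
    proof -
      have "K r * norm (xs m - xs n) < e" using N[OF that] K_pos[of r] by (simp add: field_simps)
      with diff[of m n] show ?thesis by simp
    qed
    then show "\<exists>N. \<forall>m\<ge>N. \<forall>n\<ge>N. norm (l m - l n) < e" by blast
  qed
  then obtain L where "l \<longlonglongrightarrow> L" using convergent_eq_Cauchy by blast
  with W_tendsto_approx[OF r xs(2) l] show ?thesis by blast
qed

theorem Chernoff_product_formula:
  assumes U: "generates (closure G) U" and r: "r \<ge> 0"
  shows "((\<lambda>\<tau>. W \<tau> r x) \<longlongrightarrow> U r x) (at_right 0)"
proof -
  have "x \<in> closure (Domain G)" by (simp add: dense_Domain)
  then obtain xs where xs: "\<And>k. xs k \<in> Domain G" "xs \<longlonglongrightarrow> x" unfolding closure_sequential by auto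
  have "((\<lambda>\<tau>. W \<tau> r (xs k)) \<longlongrightarrow> U r (xs k)) (at_right 0)" for k
  proof -
    obtain y where "(xs k, y) \<in> closure G" using xs(1)[of k] closure_subset by blast
    from classical_solution_limit[OF generates_classical_solution[OF U this] r] show ?thesis
      using U by (simp add: generates_def c0_semigroup_zero)
  qed
  moreover have "(\<lambda>k. U r (xs k)) \<longlonglongrightarrow> U r x" using xs(2) by (intro tendsto_intros)
  ultimately show ?thesis by (rule W_tendsto_approx[OF r xs(2)])
qed

text \<open>The semigroup law is the limit of its approximate version: stability allows the inner
  term of \<open>W \<tau> s (W \<tau> r x)\<close> to be replaced by its limit. Strong continuity at
  0 is equicontinuity measured against \<open>W \<tau> 0 x = x\<close>.\<close>

lemma limit_semigroup:
  assumes conv: "\<And>r x. r \<ge> 0 \<Longrightarrow> \<exists>l. ((\<lambda>\<tau>. W \<tau> r x) \<longlongrightarrow> l) (at_right 0)"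
  obtains U where "c0_semigroup U" "\<And>r x. r \<ge> 0 \<Longrightarrow> ((\<lambda>\<tau>. W \<tau> r x) \<longlongrightarrow> blinfun_apply (U r) x) (at_right 0)"
proof -
  define u where "u r x = Lim (at_right 0) (\<lambda>\<tau>. W \<tau> r x)" for r x
  have u: "((\<lambda>\<tau>. W \<tau> r x) \<longlongrightarrow> u r x) (at_right 0)" if "r \<ge> 0" for r x
    unfolding u_def using conv[OF that, of x] tendsto_Lim[of "at_right (0::real)"] by fastforce
  define U where "U r = Blinfun (u r)" for r
  have apply_U: "blinfun_apply (U r) = u r" if r: "r \<ge> 0" for r
  proof -
    have "bounded_linear (u r)"
    proof (rule bounded_linear_intro)
      show "u r (x + y) = u r x + u r y" for x y
        by (rule tendsto_unique[OF _ u[OF r]]) (auto simp: W_add intro!: tendsto_add u r)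
      show "u r (c *\<^sub>R x) = c *\<^sub>R u r x" for c x
        by (rule tendsto_unique[OF _ u[OF r]]) (auto simp: W_scaleR intro!: tendsto_scaleR u r)
      show "norm (u r x) \<le> norm x * K r" for x
        using W_limit_norm_le[OF r u[OF r]] by (simp add: mult.commute)
    qed
    then show ?thesis unfolding U_def by (rule bounded_linear_Blinfun_apply)
  qed
  have "U 0 = id_blinfun"
  proof (rule blinfun_eqI)
    fix x show "U 0 x = id_blinfun x"
      using tendsto_unique[OF _ u[of 0 x], of x] by (simp add: apply_U)
  qed
  moreover have "U (s + r) = U s o\<^sub>L U r" if s: "s \<ge> 0" and r: "r \<ge> 0" for s r
  proof (rule blinfun_eqI)
    fix x
    have "((\<lambda>\<tau>. W \<tau> s (W \<tau> r x - u r x)) \<longlongrightarrow> 0) (at_right 0)"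
    proof (rule Lim_null_comparison)
      have "\<forall>\<^sub>F \<tau> in at_right (0::real). \<tau> > 0" by (rule eventually_at_right_less)
      then show "\<forall>\<^sub>F \<tau> in at_right 0. norm (W \<tau> s (W \<tau> r x - u r x)) \<le> K s * norm (W \<tau> r x - u r x)"
        by eventually_elim (use s in \<open>auto intro: W_bound\<close>)
      have "((\<lambda>\<tau>. norm (W \<tau> r x - u r x)) \<longlongrightarrow> 0) (at_right 0)"
        using u[OF r, of x] by (simp add: LIM_zero tendsto_norm_zero)
      then show "((\<lambda>\<tau>. K s * norm (W \<tau> r x - u r x)) \<longlongrightarrow> 0) (at_right 0)"
        by (rule tendsto_mult_right_zero)
    qed
    from tendsto_add[OF tendsto_add[OF W_compose_tendsto[OF s r, of x] this] u[OF s, of "u r x"]]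
    have "((\<lambda>\<tau>. W \<tau> (s + r) x) \<longlongrightarrow> u s (u r x)) (at_right 0)" by (simp add: W_diff)
    then have "u (s + r) x = u s (u r x)" using u[of "s + r" x] s r by (intro tendsto_unique) auto
    then show "U (s + r) x = (U s o\<^sub>L U r) x" using s r by (simp add: apply_U)
  qed
  moreover have "((\<lambda>s. U s x) \<longlongrightarrow> x) (at_right 0)" for x
  proof (rule tendstoI)
    fix e :: real assume e: "e > 0"
    then have "e / 2 > 0" by simp
    then obtain d where "d > 0" and d:
      "\<And>\<tau> s r. 0 < \<tau> \<Longrightarrow> \<tau> < d \<Longrightarrow> 0 \<le> s \<Longrightarrow> s \<le> r \<Longrightarrow> r \<le> 1 \<Longrightarrow> r - s < d \<Longrightarrow>
        norm (W \<tau> r x - W \<tau> s x) \<le> e / 2"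
      using W_uniformly_equicontinuous[of "e / 2" 1 x] by blast
    have "dist (U h x) x < e" if h: "0 < h" "h < min d 1" for h
    proof -
      have "\<forall>\<^sub>F \<tau> in at_right 0. norm (W \<tau> h x - x) \<le> e / 2"
        using d[of _ 0 h] h by (intro eventually_at_right_0_I[OF \<open>d > 0\<close>]) auto
      moreover have "((\<lambda>\<tau>. W \<tau> h x - x) \<longlongrightarrow> U h x - x) (at_right 0)"
        using u[of h x] h by (auto simp: apply_U intro!: tendsto_intros)
      ultimately have "norm (U h x - x) \<le> e / 2" by (intro Lim_norm_ubound[of "at_right 0"]) auto
      then show ?thesis using e by (simp add: dist_norm)
    qed
    then show "\<forall>\<^sub>F h in at_right 0. dist (U h x) x < e"
      using \<open>d > 0\<close> by (intro eventually_at_right_0_I[of "min d 1"]) auto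
  qed
  ultimately have "c0_semigroup U" by (simp add: c0_semigroup_def)
  then show ?thesis using u by (intro that) (auto simp: apply_U)
qed

text \<open>
  An element of the generator is recovered from the time averages of the solutions starting in \<open>A\<close>,
  which belong to the closed graph; Riemann sums obtained by bisection stand in for the integral.
\<close>
theorem closure_generates:
  assumes A: "closure A = UNIV"
    and sol: "\<And>f. f \<in> A \<Longrightarrow> \<exists>u w. classical_solution (closure G) u w \<and> u 0 = f"
  shows "\<exists>U. generates (closure G) U"
proof -
  have "\<exists>l. ((\<lambda>\<tau>. W \<tau> r x) \<longlongrightarrow> l) (at_right 0)" if "r \<ge> 0" for r x
  proof (rule W_convergent_dense[OF A that])
    fix f assume "f \<in> A"
    then obtain u w where "classical_solution (closure G) u w" "u 0 = f" using sol by blast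
    then show "\<exists>l. ((\<lambda>\<tau>. W \<tau> r f) \<longlongrightarrow> l) (at_right 0)"
      using classical_solution_limit[OF _ that] by blast
  qed
  then obtain U where c0: "c0_semigroup U"
    and U: "\<And>r x. r \<ge> 0 \<Longrightarrow> ((\<lambda>\<tau>. W \<tau> r x) \<longlongrightarrow> blinfun_apply (U r) x) (at_right 0)"
    using limit_semigroup by blast
  have U_bound: "norm (U r x) \<le> K 1 * norm x" if "0 \<le> r" "r \<le> 1" for r x
    using W_limit_norm_le[OF that(1) U[OF that(1)]] K_mono[OF that(2)]
    by (meson mult_right_mono norm_ge_zero order_trans)
  have "closure G \<subseteq> strong_deriv0 U"
  proof (rule subrelI)
    fix x y assume xy: "(x, y) \<in> closure G"
    show "(x, y) \<in> strong_deriv0 U"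
      unfolding strong_deriv0_iff
    proof (intro allI impI)
      fix e :: real assume e: "e > 0"
      obtain d where "d > 0" and d0: "\<And>x z h. (x, z) \<in> closure G \<Longrightarrow> norm (z - y) < d \<Longrightarrow>
          0 < h \<Longrightarrow> h < d \<Longrightarrow> \<forall>\<^sub>F \<tau> in at_right 0. norm (W \<tau> h x - x - h *\<^sub>R z) \<le> e * h"
        using first_order_estimate[OF e, where ?y0.0 = y] by blast
      have d: "\<forall>\<^sub>F \<tau> in at_right 0. norm (W \<tau> h x - x - h *\<^sub>R y) \<le> e * h" if "0 < h" "h < d" for h
        using d0[OF xy _ that] \<open>d > 0\<close> by simp
      have "norm (U h x - x - h *\<^sub>R y) \<le> e * h" if h: "0 < h" "h < d" for h
      proof -
        have "((\<lambda>\<tau>. W \<tau> h x - x - h *\<^sub>R y) \<longlongrightarrow> U h x - x - h *\<^sub>R y) (at_right 0)"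
          using h by (intro tendsto_intros U) auto
        with d[OF h] show ?thesis by (intro Lim_norm_ubound[of "at_right 0"]) auto
      qed
      with \<open>d > 0\<close> show "\<exists>d>0. \<forall>h. 0 < h \<and> h < d \<longrightarrow> norm (U h x - x - h *\<^sub>R y) \<le> e * h" by blast
    qed
  qed
  moreover have "strong_deriv0 U \<subseteq> closure G"
  proof (rule subrelI)
    fix x y assume xy: "(x, y) \<in> strong_deriv0 U"
    have "\<exists>z\<in>closure G. dist z (x, y) < e0" if e0: "e0 > 0" for e0
    proof -
      define k where "k = K 1"
      have k: "k \<ge> 1" using K_ge_1[of 1] by (simp add: k_def)
      \<comment> \<open>The two components will end up with errors \<open>(k + 1) * e\<close> and
        \<open>(k + 3) * e\<close>, whose sum is \<open>e0 / 2\<close>.\<close>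
      define e where "e = e0 / (4 * (k + 2))"
      have e: "e > 0" "e * (4 * (k + 2)) = e0" using e0 k by (auto simp: e_def)
      obtain d1 where d1: "d1 > 0" "\<And>h. 0 < h \<Longrightarrow> h < d1 \<Longrightarrow> norm (U h x - x - h *\<^sub>R y) \<le> e * h"
        using xy e(1) unfolding strong_deriv0_iff by meson
      obtain d2 where d2: "d2 > 0" "\<And>h. 0 < h \<Longrightarrow> h < d2 \<Longrightarrow> dist (U h x) x < e"
        using tendstoD[OF c0_semigroup_tendsto[OF c0, of x] e(1)] eventually_at_right_0_D by auto
      define r where "r = min (min d1 d2) 1 / 2"
      have r: "0 < r" "r < d1" "r < d2" "r < 1" using d1 d2 by (auto simp: r_def min_def)
      have er: "e * r > 0" "e * r \<le> e" using e r by auto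
      have "x \<in> closure A" by (simp add: A)
      \<comment> \<open>The distance must be small relative to \<open>r\<close>, because the
        increment of the solution is finally divided by \<open>r\<close>.\<close>
      then obtain f where "f \<in> A" and f: "dist f x < e * r"
        using er(1) unfolding closure_approachable by blast
      then obtain u w where uw: "classical_solution (closure G) u w" "u 0 = f" using sol by blast
      have G: "\<And>s. s \<ge> 0 \<Longrightarrow> (u s, w s) \<in> closure G"
        and diff: "\<And>R e. e > 0 \<Longrightarrow> \<exists>d>0. \<forall>s h. 0 \<le> s \<and> s \<le> R \<and> 0 < h \<and> h < d \<longrightarrow>
          norm (u (s + h) - u s - h *\<^sub>R w s) \<le> e * h"
        using uw(1) by (auto simp: classical_solution_def)
      have u_eq: "u s = U s f" if "s \<ge> 0" for s
        using classical_solution_limit[OF uw(1) that] U[OF that, of f] uw(2)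
        by (intro tendsto_unique[of "at_right (0::real)"]) auto
      have Ufx: "norm (U s (f - x)) \<le> k * (e * r)" if "0 \<le> s" "s \<le> r" for s
      proof -
        have "norm (U s (f - x)) \<le> k * norm (f - x)" unfolding k_def using that r by (intro U_bound) auto
        also have "\<dots> \<le> k * (e * r)" using f k by (intro mult_left_mono) (auto simp: dist_norm)
        finally show ?thesis .
      qed
      define c where "c = k * e + e"
      have u_near: "norm (u s - x) \<le> c" if s: "0 \<le> s" "s \<le> r" for s
      proof -
        have "norm (U s x - x) \<le> e"
          using d2(2)[of s] s r e c0 by (cases "s = 0") (auto simp: dist_norm c0_semigroup_zero)
        moreover have "norm (U s (f - x)) \<le> k * e"
          using Ufx[OF s] er k by (meson mult_left_mono order_trans zero_le_one)
        moreover have "u s - x = U s (f - x) + (U s x - x)"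
          using u_eq[OF s(1)] by (simp add: blinfun.diff_right)
        ultimately show ?thesis unfolding c_def by (metis norm_triangle_mono)
      qed
      \<comment> \<open>\<open>p\<close> stands for the integral of \<open>u\<close> over the
        interval and \<open>q\<close> for that of \<open>w\<close>. Only their closeness to a
        multiple of \<open>x\<close> and to the increment of \<open>u\<close> is recorded; both
        errors are additive.\<close>
      define Q where "Q s1 s2 \<longleftrightarrow> (0 \<le> s1 \<and> s2 \<le> r \<longrightarrow> (\<exists>p q. (p, q) \<in> closure G \<and>
          norm (p - (s2 - s1) *\<^sub>R x) \<le> c * (s2 - s1) \<and> norm (q - (u s2 - u s1)) \<le> e * (s2 - s1)))"
        for s1 s2
      have "Q 0 r"
        using less_imp_le[OF r(1)]
      proof (induction rule: Bolzano)
        case (trans s1 s2 s3)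
        show ?case
          unfolding Q_def
        proof
          assume s: "0 \<le> s1 \<and> s3 \<le> r"
          then obtain p1 q1 where 1: "(p1, q1) \<in> closure G"
              "norm (p1 - (s2 - s1) *\<^sub>R x) \<le> c * (s2 - s1)" "norm (q1 - (u s2 - u s1)) \<le> e * (s2 - s1)"
            using trans unfolding Q_def by auto
          obtain p2 q2 where 2: "(p2, q2) \<in> closure G"
              "norm (p2 - (s3 - s2) *\<^sub>R x) \<le> c * (s3 - s2)" "norm (q2 - (u s3 - u s2)) \<le> e * (s3 - s2)"
            using s trans unfolding Q_def by auto
          have "(p1, q1) + (p2, q2) \<in> closure G"
            using 1(1) 2(1) by (intro subspace_add subspace_closure_G)
          moreover have "norm (p1 + p2 - (s3 - s1) *\<^sub>R x) \<le> c * (s3 - s1)"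
            using norm_triangle_mono[OF 1(2) 2(2)] by (simp add: algebra_simps)
          moreover have "norm (q1 + q2 - (u s3 - u s1)) \<le> e * (s3 - s1)"
            using norm_triangle_mono[OF 1(3) 2(3)] by (simp add: algebra_simps)
          ultimately show "\<exists>p q. (p, q) \<in> closure G \<and> norm (p - (s3 - s1) *\<^sub>R x) \<le> c * (s3 - s1) \<and>
              norm (q - (u s3 - u s1)) \<le> e * (s3 - s1)"
            by auto
        qed
      next
        case (local s)
        obtain d where d: "d > 0" "\<And>s h. 0 \<le> s \<Longrightarrow> s \<le> r \<Longrightarrow> 0 < h \<Longrightarrow> h < d \<Longrightarrow>
            norm (u (s + h) - u s - h *\<^sub>R w s) \<le> e * h"
          using diff[OF e(1), of r] by auto
        have "Q s1 s2" if s12: "s1 \<le> s" "s \<le> s2" "s2 - s1 < d" for s1 s2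
          unfolding Q_def
        proof
          assume s: "0 \<le> s1 \<and> s2 \<le> r"
          \<comment> \<open>On a short interval a single left-endpoint Riemann term,
            \<open>h\<close> times \<open>(u s1, w s1)\<close>, suffices.\<close>
          define h where "h = s2 - s1"
          have h: "h \<ge> 0" "h < d" "s2 = s1 + h" using s12 by (auto simp: h_def)
          have "h *\<^sub>R (u s1, w s1) \<in> closure G"
            using G s by (intro subspace_scale subspace_closure_G) auto
          moreover have "norm (h *\<^sub>R u s1 - h *\<^sub>R x) \<le> c * h"
          proof -
            have "norm (h *\<^sub>R u s1 - h *\<^sub>R x) = h * norm (u s1 - x)"
              using h by (simp flip: scaleR_right_diff_distrib)
            also have "\<dots> \<le> h * c" using u_near[of s1] s s12 h by (intro mult_left_mono) auto
            finally show ?thesis by (simp add: mult.commute)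
          qed
          moreover have "norm (h *\<^sub>R w s1 - (u (s1 + h) - u s1)) \<le> e * h"
          proof (cases "h = 0")
            case False
            then show ?thesis using d(2)[of s1 h] s s12 h by (simp add: norm_minus_commute)
          qed simp
          ultimately show "\<exists>p q. (p, q) \<in> closure G \<and> norm (p - (s2 - s1) *\<^sub>R x) \<le> c * (s2 - s1) \<and>
              norm (q - (u s2 - u s1)) \<le> e * (s2 - s1)"
            unfolding h(3) by auto
        qed
        with d(1) show ?case by blast
      qed
      then obtain p q where pq: "(p, q) \<in> closure G" "norm (p - r *\<^sub>R x) \<le> c * r"
          "norm (q - (u r - u 0)) \<le> e * r"
        using r by (auto simp: Q_def)
      have "norm (q - r *\<^sub>R y) \<le> (k + 3) * (e * r)"
      proof -
        have "norm (U r x - x - r *\<^sub>R y) \<le> e * r" using r by (intro d1) auto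
        moreover have "norm (U r (f - x)) \<le> k * (e * r)" using Ufx r by auto
        moreover have "norm (f - x) \<le> e * r" using f by (simp add: dist_norm)
        moreover have "q - r *\<^sub>R y =
            (q - (u r - u 0)) + (U r x - x - r *\<^sub>R y) + U r (f - x) - (f - x)"
          using u_eq[of r] uw(2) r by (simp add: blinfun.diff_right)
        then have "norm (q - r *\<^sub>R y) \<le>
            norm (q - (u r - u 0)) + norm (U r x - x - r *\<^sub>R y) + norm (U r (f - x)) + norm (f - x)"
          by (smt (verit) norm_triangle_ineq norm_triangle_ineq4)
        ultimately show ?thesis using pq(3) by (simp add: algebra_simps)
      qed
      moreover have "norm (p - r *\<^sub>R x) \<le> (k + 1) * (e * r)" using pq(2) by (simp add: c_def algebra_simps)
      moreover have scale: "norm (z /\<^sub>R r - z') \<le> b * e"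
        if "norm (z - r *\<^sub>R z') \<le> b * (e * r)" for z z' :: 'a and b
      proof -
        have "z /\<^sub>R r - z' = (z - r *\<^sub>R z') /\<^sub>R r" using r by (simp add: scaleR_diff_right)
        then have "norm (z /\<^sub>R r - z') = norm (z - r *\<^sub>R z') / r"
          using r by (simp add: divide_inverse mult.commute)
        also have "\<dots> \<le> b * (e * r) / r" using that r by (intro divide_right_mono) auto
        also have "\<dots> = b * e" using r by simp
        finally show ?thesis .
      qed
      ultimately have "norm (p /\<^sub>R r - x) \<le> (k + 1) * e" "norm (q /\<^sub>R r - y) \<le> (k + 3) * e"
        by blast+
      then have "norm ((p /\<^sub>R r, q /\<^sub>R r) - (x, y)) \<le> (k + 1) * e + (k + 3) * e"
        using norm_Pair_le[of "p /\<^sub>R r - x" "q /\<^sub>R r - y"] by simp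
      also have "\<dots> = e * (4 * (k + 2)) / 2" by (simp add: algebra_simps)
      also have "\<dots> = e0 / 2" using e(2) by metis
      also have "\<dots> < e0" using e0 by simp
      finally have "dist ((p, q) /\<^sub>R r) (x, y) < e0" by (simp add: dist_norm)
      moreover have "(p, q) /\<^sub>R r \<in> closure G"
        using pq(1) by (intro subspace_scale subspace_closure_G)
      ultimately show ?thesis by blast
    qed
    then have "(x, y) \<in> closure (closure G)" unfolding closure_approachable by blast
    then show "(x, y) \<in> closure G" by simp
  qed
  ultimately have "generates (closure G) U" using c0 by (auto simp: generates_def)
  then show ?thesis by blast
qed

end

subsection \<open>Weakly compact approximations\<close>

lemma weak_limit_perturb:
  fixes f g :: "nat \<Rightarrow> 'a::real_normed_vector" and \<phi> :: "'a \<Rightarrow>\<^sub>L real"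
  assumes "(\<lambda>n. \<phi> (g n)) \<longlonglongrightarrow> \<phi> l" "(\<lambda>n. norm (f n - g n)) \<longlonglongrightarrow> 0"
  shows "(\<lambda>n. \<phi> (f n)) \<longlonglongrightarrow> \<phi> l"
proof -
  have "(\<lambda>n. f n - g n) \<longlonglongrightarrow> 0" using assms(2) by (simp add: tendsto_norm_zero_iff)
  then have "(\<lambda>n. \<phi> (f n - g n)) \<longlonglongrightarrow> \<phi> 0" by (intro tendsto_intros)
  from tendsto_add[OF this assms(1)] show ?thesis by (simp add: blinfun.diff_right)
qed

text \<open>A functional on the product is the sum of its restrictions to the two axes. Mazur's
  theorem thereby applies to graphs when the components converge weakly.\<close>

lemma weak_limit_Pair:
  fixes f :: "nat \<Rightarrow> 'a::real_normed_vector" and g :: "nat \<Rightarrow> 'b::real_normed_vector"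
    and \<Phi> :: "('a \<times> 'b) \<Rightarrow>\<^sub>L real"
  assumes "\<And>\<phi> :: 'a \<Rightarrow>\<^sub>L real. (\<lambda>n. \<phi> (f n)) \<longlonglongrightarrow> \<phi> l" "\<And>\<phi> :: 'b \<Rightarrow>\<^sub>L real. (\<lambda>n. \<phi> (g n)) \<longlonglongrightarrow> \<phi> k"
  shows "(\<lambda>n. \<Phi> (f n, g n)) \<longlonglongrightarrow> \<Phi> (l, k)"
proof -
  define \<phi> where "\<phi> = Blinfun (\<lambda>x. \<Phi> (x, 0))"
  define \<psi> where "\<psi> = Blinfun (\<lambda>y. \<Phi> (0, y))"
  have "bounded_linear (\<lambda>x. \<Phi> (x, 0))" "bounded_linear (\<lambda>y. \<Phi> (0, y))"
    by (intro bounded_linear_compose[OF blinfun.bounded_linear_right] bounded_linear_Pair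
        bounded_linear_ident bounded_linear_zero)+
  then have eq: "\<Phi> (x, y) = \<phi> x + \<psi> y" for x y
    by (simp add: \<phi>_def \<psi>_def bounded_linear_Blinfun_apply flip: blinfun.add_right)
  show ?thesis unfolding eq by (intro tendsto_add assms)
qed

lemma tendsto_imp_weakly_subseq_compact:
  assumes "f \<longlonglongrightarrow> l"
  shows "weakly_subseq_compact f"
  unfolding weakly_subseq_compact_def
proof (intro allI impI)
  fix r :: "nat \<Rightarrow> nat" assume r: "strict_mono r"
  have "(f \<circ> r) \<longlonglongrightarrow> l" using assms r by (rule LIMSEQ_subseq_LIMSEQ)
  then have "weakly_convergent (f \<circ> r \<circ> id)"
    unfolding weakly_convergent_def by (auto simp: comp_def intro!: exI[of _ l] tendsto_intros)
  then show "\<exists>q::nat \<Rightarrow> nat. strict_mono q \<and> weakly_convergent (f \<circ> r \<circ> q)"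
    using strict_mono_id by blast
qed

lemma strict_mono_filterlim_at_right_0:
  assumes "t > 0" "strict_mono (\<rho> :: nat \<Rightarrow> nat)"
  shows "filterlim (\<lambda>n. t / real (\<rho> n)) (at_right 0) sequentially"
proof -
  have \<rho>: "filterlim \<rho> at_top sequentially" using assms(2) by (rule filterlim_subseq)
  have "(\<lambda>n. t / real n) \<longlonglongrightarrow> 0" by (rule lim_const_over_n)
  then have "(\<lambda>n. t / real (\<rho> n)) \<longlonglongrightarrow> 0" using \<rho> by (rule filterlim_compose)
  moreover have "\<forall>\<^sub>F n in sequentially. \<rho> n > 0"
    using eventually_compose_filterlim[OF eventually_gt_at_top[of 0] \<rho>] .
  then have "\<forall>\<^sub>F n in sequentially. t / real (\<rho> n) \<in> {0<..} \<and> t / real (\<rho> n) \<noteq> 0"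
    by eventually_elim (use assms(1) in simp)
  ultimately show ?thesis by (simp add: filterlim_at)
qed

context chernoff_family
begin

text \<open>Equicontinuity in time and stability in the vector approximate any time and any
  \<open>x\<close> by a rational time and an element of \<open>Z\<close>, with an error uniform in
  small \<open>\<tau>\<close>.\<close>

lemma weakly_convergent_W_dense:
  assumes \<sigma>: "filterlim \<sigma> (at_right 0) sequentially"
    and conv: "\<And>z q. z \<in> Z \<Longrightarrow> q \<in> \<rat> \<Longrightarrow> q \<ge> 0 \<Longrightarrow> weakly_convergent (\<lambda>n. W (\<sigma> n) q z)"
    and x: "x \<in> closure Z" and s: "s \<ge> 0"
  shows "weakly_convergent (\<lambda>n. W (\<sigma> n) s x)"
proof (rule weakly_convergent_approx)
  fix e :: real assume e: "e > 0"
  then have "e / 2 > 0" by simp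
  then obtain d where "d > 0" and d:
    "\<And>\<tau> r q. 0 < \<tau> \<Longrightarrow> \<tau> < d \<Longrightarrow> 0 \<le> r \<Longrightarrow> r \<le> q \<Longrightarrow> q \<le> s + 1 \<Longrightarrow> q - r < d \<Longrightarrow>
      norm (W \<tau> q x - W \<tau> r x) \<le> e / 2"
    using W_uniformly_equicontinuous[of "e / 2" "s + 1" x] by blast
  obtain q where q: "q \<in> \<rat>" "s < q" "q < s + min d 1"
    using Rats_dense_in_real[of s "s + min d 1"] \<open>d > 0\<close> by auto
  have "e / (2 * K (s + 1)) > 0" using e K_pos[of "s + 1"] by simp
  then obtain z where z: "z \<in> Z" "dist z x < e / (2 * K (s + 1))"
    using x unfolding closure_approachable by blast
  have "\<forall>\<^sub>F \<tau> in at_right 0. norm (W \<tau> s x - W \<tau> q z) \<le> e"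
  proof (rule eventually_at_right_0_I[OF \<open>d > 0\<close>])
    fix \<tau> assume \<tau>: "0 < \<tau>" "\<tau> < d"
    have 1: "norm (W \<tau> q x - W \<tau> s x) \<le> e / 2" using q s \<tau> by (intro d) auto
    have "norm (W \<tau> q (x - z)) \<le> K (s + 1) * norm (x - z)" using q s \<tau> by (intro W_bound) auto
    also have "\<dots> \<le> K (s + 1) * (e / (2 * K (s + 1)))"
      using z K_pos[of "s + 1"] by (intro mult_left_mono) (auto simp: dist_norm norm_minus_commute)
    also have "\<dots> = e / 2" using K_pos[of "s + 1"] by simp
    finally have 2: "norm (W \<tau> q (x - z)) \<le> e / 2" .
    have "W \<tau> s x - W \<tau> q z = W \<tau> q (x - z) - (W \<tau> q x - W \<tau> s x)" by (simp add: W_diff)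
    then have "norm (W \<tau> s x - W \<tau> q z) \<le> norm (W \<tau> q (x - z)) + norm (W \<tau> q x - W \<tau> s x)"
      using norm_triangle_ineq4 by metis
    with 1 2 show "norm (W \<tau> s x - W \<tau> q z) \<le> e" by simp
  qed
  from eventually_compose_filterlim[OF this \<sigma>]
  show "\<exists>g. weakly_convergent g \<and> (\<forall>\<^sub>F n in sequentially. norm (W (\<sigma> n) s x - g n) \<le> e)"
    using conv[OF z(1) q(1)] q(2) s by (intro exI[of _ "\<lambda>n. W (\<sigma> n) q z"]) auto
qed

lemma weakly_convergent_diagonal:
  fixes s :: "nat \<Rightarrow> real" and x :: "nat \<Rightarrow> 'a"
  assumes sub: "\<And>i (\<rho> :: nat \<Rightarrow> nat). strict_mono \<rho> \<Longrightarrow>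
    \<exists>q. strict_mono q \<and> weakly_convergent (\<lambda>n. W (t / real ((\<rho> \<circ> q) n)) (s i) (x i))"
  obtains \<rho> :: "nat \<Rightarrow> nat" where "strict_mono \<rho>"
    "\<And>i. weakly_convergent (\<lambda>n. W (t / real (\<rho> n)) (s i) (x i))"
proof -
  define P where "P i \<rho> = weakly_convergent (\<lambda>n. W (t / real (\<rho> n)) (s i) (x i))" for i :: nat and \<rho> :: "nat \<Rightarrow> nat"
  interpret subseqs P
    by unfold_locales (unfold P_def, rule sub)
  have stable: "P i (\<rho> \<circ> q)" if q: "strict_mono q" and P: "P i \<rho>" for i \<rho> q
  proof -
    obtain l where l: "\<And>\<phi> :: 'a \<Rightarrow>\<^sub>L real. (\<lambda>n. \<phi> (W (t / real (\<rho> n)) (s i) (x i))) \<longlonglongrightarrow> \<phi> l"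
      using P by (auto simp: P_def weakly_convergent_def)
    show ?thesis
      unfolding P_def weakly_convergent_def
      using LIMSEQ_subseq_LIMSEQ[OF l q] by (auto simp: comp_def intro!: exI[of _ l])
  qed
  have "P i diagseq" for i
  proof -
    \<comment> \<open>The diagonal is a subsequence of the \<open>i\<close>-th selection only after
      its first \<open>Suc i\<close> terms are dropped; the shift is undone below.\<close>
    have "P i (diagseq \<circ> (+) (Suc i))" by (rule diagseq_holds) (rule stable)
    then obtain l where l: "\<And>\<phi> :: 'a \<Rightarrow>\<^sub>L real.
        (\<lambda>n. \<phi> (W (t / real (diagseq (n + Suc i))) (s i) (x i))) \<longlonglongrightarrow> \<phi> l"
      by (auto simp: P_def weakly_convergent_def add.commute)
    have "(\<lambda>n. \<phi> (W (t / real (diagseq n)) (s i) (x i))) \<longlonglongrightarrow> \<phi> l" for \<phi> :: "'a \<Rightarrow>\<^sub>L real"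
      by (rule LIMSEQ_offset[OF l])
    then show ?thesis unfolding P_def weakly_convergent_def by blast
  qed
  then show ?thesis using that[OF subseq_diagseq] by (simp add: P_def)
qed

text \<open>\<open>\<phi>\<close> of the difference quotient at \<open>x\<close> is read in two
  ways. In effect \<open>\<psi>\<close> is the value at \<open>\<phi>\<close> of the adjoint of
  \<open>G\<close>.\<close>

lemma adjoint_derivative_graph:
  fixes \<phi> \<psi> :: "'a \<Rightarrow>\<^sub>L real"
  assumes \<psi>: "((\<lambda>\<tau>. ((\<phi> o\<^sub>L V \<tau>) - \<phi>) /\<^sub>R \<tau>) \<longlongrightarrow> \<psi>) (at_right 0)" and xy: "(x, y) \<in> G"
  shows "\<phi> y = \<psi> x"
proof -
  have "((\<lambda>\<tau>. \<phi> ((V \<tau> x - x) /\<^sub>R \<tau>)) \<longlongrightarrow> \<phi> y) (at_right 0)"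
    using consistent[OF xy] by (intro tendsto_intros)
  moreover have "((\<lambda>\<tau>. (((\<phi> o\<^sub>L V \<tau>) - \<phi>) /\<^sub>R \<tau>) x) \<longlongrightarrow> \<psi> x) (at_right 0)"
    using \<psi> by (intro tendsto_intros)
  then have "((\<lambda>\<tau>. \<phi> ((V \<tau> x - x) /\<^sub>R \<tau>)) \<longlongrightarrow> \<psi> x) (at_right 0)"
    by (simp add: blinfun.bilinear_simps)
  ultimately show ?thesis by (intro tendsto_unique[of "at_right (0::real)"]) auto
qed

text \<open>Since \<open>V \<tau>\<close> commutes with its powers, the difference quotient at
  \<open>x\<close> can be moved onto \<open>\<phi>\<close>. Norm convergence there compensates for
  \<open>W (\<sigma> n) s x\<close> being merely bounded, with convergence assumed only under
  \<open>\<psi>\<close>.\<close>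

lemma adjoint_derivative_limit:
  fixes \<phi> \<psi> :: "'a \<Rightarrow>\<^sub>L real"
  assumes \<psi>: "((\<lambda>\<tau>. ((\<phi> o\<^sub>L V \<tau>) - \<phi>) /\<^sub>R \<tau>) \<longlongrightarrow> \<psi>) (at_right 0)" and xy: "(x, y) \<in> G"
    and s: "s \<ge> 0" and \<sigma>: "filterlim \<sigma> (at_right 0) sequentially"
    and l: "(\<lambda>n. \<psi> (W (\<sigma> n) s x)) \<longlonglongrightarrow> l"
  shows "(\<lambda>n. \<phi> (W (\<sigma> n) s y)) \<longlonglongrightarrow> l"
proof -
  define \<theta> where "\<theta> n = ((\<phi> o\<^sub>L V (\<sigma> n)) - \<phi>) /\<^sub>R \<sigma> n" for n
  define z where "z n = (V (\<sigma> n) x - x) /\<^sub>R \<sigma> n" for n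
  have pos: "\<forall>\<^sub>F n in sequentially. \<sigma> n > 0"
    using eventually_compose_filterlim[OF eventually_at_right_less \<sigma>] .
  have \<theta>: "\<theta> \<longlonglongrightarrow> \<psi>" unfolding \<theta>_def by (rule filterlim_compose[OF \<psi> \<sigma>])
  have z: "z \<longlonglongrightarrow> y" unfolding z_def by (rule filterlim_compose[OF consistent[OF xy] \<sigma>])
  have comm: "\<phi> (W (\<sigma> n) s (z n)) = \<theta> n (W (\<sigma> n) s x)" for n
  proof -
    have "W (\<sigma> n) s (V (\<sigma> n) x) = V (\<sigma> n) (W (\<sigma> n) s x)" by (simp add: W_def funpow_swap1)
    then show ?thesis
      by (simp add: z_def \<theta>_def W_diff W_scaleR blinfun.bilinear_simps)
  qed
  have "(\<lambda>n. (\<theta> n - \<psi>) (W (\<sigma> n) s x)) \<longlonglongrightarrow> 0"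
  proof (rule Lim_null_comparison)
    show "\<forall>\<^sub>F n in sequentially. norm ((\<theta> n - \<psi>) (W (\<sigma> n) s x)) \<le> norm (\<theta> n - \<psi>) * (K s * norm x)"
      using pos
    proof eventually_elim
      case (elim n)
      have "norm ((\<theta> n - \<psi>) (W (\<sigma> n) s x)) \<le> norm (\<theta> n - \<psi>) * norm (W (\<sigma> n) s x)"
        by (rule norm_blinfun)
      also have "\<dots> \<le> norm (\<theta> n - \<psi>) * (K s * norm x)"
        using elim s by (intro mult_left_mono W_bound) auto
      finally show ?case .
    qed
    show "(\<lambda>n. norm (\<theta> n - \<psi>) * (K s * norm x)) \<longlonglongrightarrow> 0"
      using \<theta> by (intro tendsto_mult_left_zero tendsto_norm_zero LIM_zero)
  qed
  from tendsto_add[OF this l] have lim: "(\<lambda>n. \<phi> (W (\<sigma> n) s (z n))) \<longlonglongrightarrow> l"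
    by (simp add: comm blinfun.bilinear_simps)
  have "(\<lambda>n. \<phi> (W (\<sigma> n) s (z n - y))) \<longlonglongrightarrow> 0"
  proof (rule Lim_null_comparison)
    show "\<forall>\<^sub>F n in sequentially. norm (\<phi> (W (\<sigma> n) s (z n - y))) \<le> norm \<phi> * (K s * norm (z n - y))"
      using pos
    proof eventually_elim
      case (elim n)
      have "norm (\<phi> (W (\<sigma> n) s (z n - y))) \<le> norm \<phi> * norm (W (\<sigma> n) s (z n - y))"
        by (rule norm_blinfun)
      also have "\<dots> \<le> norm \<phi> * (K s * norm (z n - y))"
        using elim s by (intro mult_left_mono W_bound) auto
      finally show ?case .
    qed
    show "(\<lambda>n. norm \<phi> * (K s * norm (z n - y))) \<longlonglongrightarrow> 0"
      using z by (intro tendsto_mult_right_zero tendsto_norm_zero LIM_zero)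
  qed
  from tendsto_diff[OF lim this] show "(\<lambda>n. \<phi> (W (\<sigma> n) s y)) \<longlonglongrightarrow> l"
    by (simp add: W_diff blinfun.diff_right)
qed

text \<open>One subsequence, fixed in advance, defines \<open>u\<close> and \<open>w\<close> at all
  times. The values of \<open>G\<close> at the approximants converge along further subsequences that
  depend on \<open>s\<close>; this is harmless because \<open>u s\<close> and \<open>w s\<close> are
  already determined.\<close>

theorem weak_limits_solve:
  fixes B :: "('a \<Rightarrow>\<^sub>L real) set"
  assumes t: "t > 0" and A: "A \<subseteq> Domain G" "closure A = UNIV"
    and separating: "\<And>z. (\<And>\<phi>. \<phi> \<in> B \<Longrightarrow> blinfun_apply \<phi> z = 0) \<Longrightarrow> z = 0"
    and adjoint: "\<And>\<phi>. \<phi> \<in> B \<Longrightarrow> \<exists>\<psi>. ((\<lambda>\<tau>. ((\<phi> o\<^sub>L V \<tau>) - \<phi>) /\<^sub>R \<tau>) \<longlongrightarrow> \<psi>) (at_right 0)"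
    and approx: "\<And>f s. f \<in> A \<Longrightarrow> s \<ge> 0 \<Longrightarrow> \<exists>g h. (\<forall>n. (g n, h n) \<in> G) \<and>
      (\<lambda>n. norm (W (t / real n) s f - g n)) \<longlonglongrightarrow> 0 \<and> weakly_subseq_compact g \<and> weakly_subseq_compact h"
    and f: "f \<in> A"
  shows "\<exists>u w. classical_solution (closure G) u w \<and> u 0 = f"
proof -
  obtain y where fy: "(f, y) \<in> G" using f A(1) by auto
  \<comment> \<open>Approximants exist for starting vectors in \<open>A\<close>, which need not
    contain \<open>y\<close>; the sequence \<open>ys\<close> makes the powers at \<open>y\<close>
    accessible.\<close>
  have "y \<in> closure A" by (simp add: A)
  then obtain ys where ys: "\<And>k. ys k \<in> A" "ys \<longlonglongrightarrow> y" unfolding closure_sequential by auto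
  define Z where "Z = insert f (range ys)"
  have ZA: "Z \<subseteq> A" using f ys by (auto simp: Z_def)
  have "f \<in> closure Z" "y \<in> closure Z"
    using ys(2) closure_subset[of Z] unfolding closure_sequential[of y] by (auto simp: Z_def)
  define I where "I = Z \<times> {q \<in> \<rat>. q \<ge> (0::real)}"
  have "countable {q \<in> \<rat>. q \<ge> (0::real)}" by (rule countable_subset[OF _ countable_rat]) auto
  then have I: "countable I" "I \<noteq> {}" by (auto simp: I_def Z_def)
  have in_I: "fst (from_nat_into I i) \<in> A" "snd (from_nat_into I i) \<ge> 0" for i
    using from_nat_into[OF I(2), of i] ZA by (auto simp: I_def mem_Times_iff)
  have sub: "\<exists>q. strict_mono q \<and> weakly_convergent (\<lambda>n. W (t / real ((\<rho> \<circ> q) n)) s x)"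
    if xs: "x \<in> A" "s \<ge> 0" and \<rho>: "strict_mono \<rho>" for x s and \<rho> :: "nat \<Rightarrow> nat"
  proof -
    obtain g where g: "(\<lambda>n. norm (W (t / real n) s x - g n)) \<longlonglongrightarrow> 0" "weakly_subseq_compact g"
      using approx[OF xs] by blast
    then obtain q where q: "strict_mono q" "weakly_convergent (g \<circ> \<rho> \<circ> q)"
      using \<rho> unfolding weakly_subseq_compact_def by blast
    then obtain l where l: "\<And>\<phi> :: 'a \<Rightarrow>\<^sub>L real. (\<lambda>n. \<phi> (g ((\<rho> \<circ> q) n))) \<longlonglongrightarrow> \<phi> l"
      unfolding weakly_convergent_def by auto
    have "(\<lambda>n. norm (W (t / real ((\<rho> \<circ> q) n)) s x - g ((\<rho> \<circ> q) n))) \<longlonglongrightarrow> 0"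
      using LIMSEQ_subseq_LIMSEQ[OF g(1) strict_mono_o[OF \<rho> q(1)]] by (simp add: comp_def)
    then have "weakly_convergent (\<lambda>n. W (t / real ((\<rho> \<circ> q) n)) s x)"
      unfolding weakly_convergent_def by (intro exI[of _ l] allI weak_limit_perturb[OF l])
    with q(1) show ?thesis by blast
  qed
  obtain \<rho> :: "nat \<Rightarrow> nat" where \<rho>: "strict_mono \<rho>"
    and \<rho>_conv: "\<And>i. weakly_convergent
      (\<lambda>n. W (t / real (\<rho> n)) (snd (from_nat_into I i)) (fst (from_nat_into I i)))"
    using weakly_convergent_diagonal[of t "\<lambda>i. snd (from_nat_into I i)" "\<lambda>i. fst (from_nat_into I i)",
        OF sub[OF in_I]] by blast
  define \<sigma> where "\<sigma> n = t / real (\<rho> n)" for n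
  have \<sigma>: "filterlim \<sigma> (at_right 0) sequentially"
    unfolding \<sigma>_def by (rule strict_mono_filterlim_at_right_0[OF t \<rho>])
  have rat: "weakly_convergent (\<lambda>n. W (\<sigma> n) q z)" if "z \<in> Z" "q \<in> \<rat>" "q \<ge> 0" for z q
  proof -
    have "(z, q) \<in> I" using that by (simp add: I_def)
    then obtain i where "from_nat_into I i = (z, q)" using from_nat_into_surj[OF I(1)] by blast
    with \<rho>_conv[of i] show ?thesis by (simp add: \<sigma>_def)
  qed
  have conv: "weakly_convergent (\<lambda>n. W (\<sigma> n) s x)" if "x \<in> closure Z" "s \<ge> 0" for s x
    using \<sigma> rat that by (rule weakly_convergent_W_dense)
  have lim: "\<exists>u. \<forall>s. s \<ge> 0 \<longrightarrow> (\<forall>\<phi> :: 'a \<Rightarrow>\<^sub>L real. (\<lambda>n. \<phi> (W (\<sigma> n) s x)) \<longlonglongrightarrow> \<phi> (u s))"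
    if "x \<in> closure Z" for x
  proof (rule choice, rule allI)
    fix s
    show "\<exists>l. s \<ge> 0 \<longrightarrow> (\<forall>\<phi> :: 'a \<Rightarrow>\<^sub>L real. (\<lambda>n. \<phi> (W (\<sigma> n) s x)) \<longlonglongrightarrow> \<phi> l)"
      using conv[OF that, of s] by (cases "s \<ge> 0") (simp_all add: weakly_convergent_def)
  qed
  obtain u where "\<forall>s. s \<ge> 0 \<longrightarrow> (\<forall>\<phi> :: 'a \<Rightarrow>\<^sub>L real. (\<lambda>n. \<phi> (W (\<sigma> n) s f)) \<longlonglongrightarrow> \<phi> (u s))"
    using lim[OF \<open>f \<in> closure Z\<close>] ..
  moreover obtain w where "\<forall>s. s \<ge> 0 \<longrightarrow> (\<forall>\<phi> :: 'a \<Rightarrow>\<^sub>L real. (\<lambda>n. \<phi> (W (\<sigma> n) s y)) \<longlonglongrightarrow> \<phi> (w s))"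
    using lim[OF \<open>y \<in> closure Z\<close>] ..
  ultimately have u: "\<And>s (\<phi> :: 'a \<Rightarrow>\<^sub>L real). s \<ge> 0 \<Longrightarrow> (\<lambda>n. \<phi> (W (\<sigma> n) s f)) \<longlonglongrightarrow> \<phi> (u s)"
    and w: "\<And>s (\<phi> :: 'a \<Rightarrow>\<^sub>L real). s \<ge> 0 \<Longrightarrow> (\<lambda>n. \<phi> (W (\<sigma> n) s y)) \<longlonglongrightarrow> \<phi> (w s)"
    by blast+
  have "continuous_on {0..} w"
  proof (rule continuous_on_nonnegI)
    fix R e :: real assume e: "e > 0"
    obtain d where "d > 0" and d:
      "\<And>\<tau> s r. 0 < \<tau> \<Longrightarrow> \<tau> < d \<Longrightarrow> 0 \<le> s \<Longrightarrow> s \<le> r \<Longrightarrow> r \<le> R + 1 \<Longrightarrow> r - s < d \<Longrightarrow>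
        norm (W \<tau> r y - W \<tau> s y) \<le> e"
      using W_uniformly_equicontinuous[OF e, of "R + 1" y] by blast
    have "norm (w (s + h) - w s) \<le> e" if "0 \<le> s" "s \<le> R" "0 < h" "h < min d 1" for s h
    proof (rule weak_limit_norm_le)
      show "(\<lambda>n. \<phi> (W (\<sigma> n) (s + h) y - W (\<sigma> n) s y)) \<longlonglongrightarrow> \<phi> (w (s + h) - w s)" for \<phi> :: "'a \<Rightarrow>\<^sub>L real"
        using tendsto_diff[OF w[of "s + h" \<phi>] w[of s \<phi>]] that by (simp add: blinfun.diff_right)
      have "\<forall>\<^sub>F \<tau> in at_right 0. norm (W \<tau> (s + h) y - W \<tau> s y) \<le> e"
        using that by (intro eventually_at_right_0_I[OF \<open>d > 0\<close>] d) auto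
      then show "\<forall>\<^sub>F n in sequentially. norm (W (\<sigma> n) (s + h) y - W (\<sigma> n) s y) \<le> e"
        using \<sigma> by (rule eventually_compose_filterlim)
    qed
    then show "\<exists>d>0. \<forall>s h. 0 \<le> s \<and> s \<le> R \<and> 0 < h \<and> h < d \<longrightarrow> norm (w (s + h) - w s) \<le> e"
      using \<open>d > 0\<close> by (intro exI[of _ "min d 1"]) auto
  qed
  moreover have "\<exists>d>0. \<forall>s h. 0 \<le> s \<and> s \<le> R \<and> 0 < h \<and> h < d \<longrightarrow>
      norm (u (s + h) - u s - h *\<^sub>R w s) \<le> e * h" if e: "e > 0" for R e
  proof -
    \<comment> \<open>The choice of \<open>d\<close> uses \<open>e\<close>, \<open>R\<close> and
      \<open>y\<close> but not \<open>s\<close>, so the weak limits satisfy the increment estimate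
      uniformly in \<open>s\<close>.\<close>
    obtain d where "d > 0" and d:
      "\<And>x z s h. (x, z) \<in> closure G \<Longrightarrow> norm (z - y) < d \<Longrightarrow> 0 \<le> s \<Longrightarrow> s \<le> R \<Longrightarrow> 0 < h \<Longrightarrow> h < d \<Longrightarrow>
        \<forall>\<^sub>F \<tau> in at_right 0. norm (W \<tau> (s + h) x - W \<tau> s x - h *\<^sub>R W \<tau> s z) \<le> e * h"
      using first_order_estimate_shifted[OF e, where ?y0.0 = y and R = R] by blast
    have "norm (u (s + h) - u s - h *\<^sub>R w s) \<le> e * h" if "0 \<le> s" "s \<le> R" "0 < h" "h < d" for s h
    proof (rule weak_limit_norm_le)
      show "(\<lambda>n. \<phi> (W (\<sigma> n) (s + h) f - W (\<sigma> n) s f - h *\<^sub>R W (\<sigma> n) s y)) \<longlonglongrightarrow>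
          \<phi> (u (s + h) - u s - h *\<^sub>R w s)" for \<phi> :: "'a \<Rightarrow>\<^sub>L real"
        unfolding blinfun.diff_right blinfun.scaleR_right
        using that by (intro tendsto_intros u w) auto
      have "(f, y) \<in> closure G" using fy closure_subset by blast
      with that have "\<forall>\<^sub>F \<tau> in at_right 0. norm (W \<tau> (s + h) f - W \<tau> s f - h *\<^sub>R W \<tau> s y) \<le> e * h"
        using \<open>d > 0\<close> by (intro d) auto
      then show "\<forall>\<^sub>F n in sequentially.
          norm (W (\<sigma> n) (s + h) f - W (\<sigma> n) s f - h *\<^sub>R W (\<sigma> n) s y) \<le> e * h"
        using \<sigma> by (rule eventually_compose_filterlim)
    qed
    with \<open>d > 0\<close> show ?thesis by blast
  qed
  moreover have "(u s, w s) \<in> closure G" if s: "s \<ge> 0" for s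
  proof -
    obtain g h where gh: "\<And>n. (g n, h n) \<in> G"
      and g: "(\<lambda>n. norm (W (t / real n) s f - g n)) \<longlonglongrightarrow> 0"
      and compact: "weakly_subseq_compact g" "weakly_subseq_compact h"
      using approx[OF f s] by blast
    obtain q1 where q1: "strict_mono q1" "weakly_convergent (g \<circ> \<rho> \<circ> q1)"
      using compact(1) \<rho> unfolding weakly_subseq_compact_def by blast
    obtain q2 where q2: "strict_mono q2" "weakly_convergent (h \<circ> (\<rho> \<circ> q1) \<circ> q2)"
      using compact(2) strict_mono_o[OF \<rho> q1(1)] unfolding weakly_subseq_compact_def by blast
    define q where "q = q1 \<circ> q2"
    have q: "strict_mono q" unfolding q_def using q1(1) q2(1) by (rule strict_mono_o)
    obtain l' where l': "\<And>\<phi> :: 'a \<Rightarrow>\<^sub>L real. (\<lambda>n. \<phi> (h (\<rho> (q n)))) \<longlonglongrightarrow> \<phi> l'"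
      using q2(2) unfolding weakly_convergent_def q_def by auto
    \<comment> \<open>Condition (a) ties \<open>g\<close> to the powers at \<open>f\<close>, which
      already converge weakly to \<open>u s\<close> along \<open>\<sigma>\<close>.\<close>
    have g_u: "(\<lambda>n. \<phi> (g (\<rho> (q n)))) \<longlonglongrightarrow> \<phi> (u s)" for \<phi> :: "'a \<Rightarrow>\<^sub>L real"
    proof (rule weak_limit_perturb)
      show "(\<lambda>n. \<phi> (W (\<sigma> (q n)) s f)) \<longlonglongrightarrow> \<phi> (u s)"
        using LIMSEQ_subseq_LIMSEQ[OF u[OF s] q] by (simp add: comp_def)
      show "(\<lambda>n. norm (g (\<rho> (q n)) - W (\<sigma> (q n)) s f)) \<longlonglongrightarrow> 0"
        using LIMSEQ_subseq_LIMSEQ[OF g strict_mono_o[OF \<rho> q]]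
        by (simp add: comp_def \<sigma>_def norm_minus_commute)
    qed
    \<comment> \<open>Both vectors give \<open>\<psi> (u s)\<close> when paired with
      \<open>\<phi>\<close>: one through the powers at \<open>y\<close>, the other through the graph
      elements \<open>(g n, h n)\<close>.\<close>
    have "w s - l' = 0"
    proof (rule separating)
      fix \<phi> assume "\<phi> \<in> B"
      then obtain \<psi> where \<psi>: "((\<lambda>\<tau>. ((\<phi> o\<^sub>L V \<tau>) - \<phi>) /\<^sub>R \<tau>) \<longlongrightarrow> \<psi>) (at_right 0)" using adjoint by blast
      have "\<phi> (w s) = \<psi> (u s)"
        by (rule LIMSEQ_unique[OF w[OF s] adjoint_derivative_limit[OF \<psi> fy s \<sigma> u[OF s]]])
      moreover have "\<phi> l' = \<psi> (u s)"
        using LIMSEQ_unique[OF l'[of \<phi>], of "\<psi> (u s)"] g_u[of \<psi>]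
        by (simp add: adjoint_derivative_graph[OF \<psi> gh])
      ultimately show "\<phi> (w s - l') = 0" by (simp add: blinfun.diff_right)
    qed
    moreover have "(u s, l') \<in> closure G"
      using gh by (intro closure_subspace_weak_limit[OF subspace_G _ weak_limit_Pair[OF g_u l']])
    ultimately show ?thesis by simp
  qed
  moreover have "u 0 = f"
    by (rule eq_if_functionals_eq) (use u[of 0] in \<open>simp add: LIMSEQ_const_iff\<close>)
  ultimately show ?thesis unfolding classical_solution_def by blast
qed

end

subsection \<open>Products of two semigroups\<close>

lemma subspace_strong_deriv0: "subspace (strong_deriv0 T)"
proof (rule subspaceI)
  show "0 \<in> strong_deriv0 T" by (simp add: strong_deriv0_def zero_prod_def)
next
  fix p q assume "p \<in> strong_deriv0 T" "q \<in> strong_deriv0 T"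
  then have "((\<lambda>h. (T h (fst p) - fst p) /\<^sub>R h + (T h (fst q) - fst q) /\<^sub>R h) \<longlongrightarrow> snd p + snd q) (at_right 0)"
    by (intro tendsto_add) (auto simp: strong_deriv0_def)
  then show "p + q \<in> strong_deriv0 T"
    by (simp add: strong_deriv0_def case_prod_beta blinfun.add_right algebra_simps)
next
  fix c p assume "p \<in> strong_deriv0 T"
  then have "((\<lambda>h. c *\<^sub>R ((T h (fst p) - fst p) /\<^sub>R h)) \<longlongrightarrow> c *\<^sub>R snd p) (at_right 0)"
    by (intro tendsto_scaleR tendsto_const) (auto simp: strong_deriv0_def)
  then show "c *\<^sub>R p \<in> strong_deriv0 T"
    by (simp add: strong_deriv0_def case_prod_beta blinfun.scaleR_right scaleR_diff_right mult.commute)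
qed

lemma subspace_op_sum:
  assumes "subspace C" "subspace D"
  shows "subspace (op_sum C D)"
proof (rule subspaceI)
  show "0 \<in> op_sum C D"
    using subspace_0[OF assms(1)] subspace_0[OF assms(2)]
    by (force simp: op_sum_def zero_prod_def)
next
  fix p q assume "p \<in> op_sum C D" "q \<in> op_sum C D"
  then obtain x y z x' y' z' where p: "p = (x, y + z)" "(x, y) \<in> C" "(x, z) \<in> D"
    and q: "q = (x', y' + z')" "(x', y') \<in> C" "(x', z') \<in> D"
    by (auto simp: op_sum_def)
  have "p + q = (x + x', (y + y') + (z + z'))" by (simp add: p q)
  moreover have "(x + x', y + y') \<in> C" "(x + x', z + z') \<in> D"
    using subspace_add[OF assms(1) p(2) q(2)] subspace_add[OF assms(2) p(3) q(3)] by auto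
  ultimately show "p + q \<in> op_sum C D" unfolding op_sum_def by blast
next
  fix c p assume "p \<in> op_sum C D"
  then obtain x y z where p: "p = (x, y + z)" "(x, y) \<in> C" "(x, z) \<in> D"
    by (auto simp: op_sum_def)
  have "c *\<^sub>R p = (c *\<^sub>R x, c *\<^sub>R y + c *\<^sub>R z)" by (simp add: p scaleR_add_right)
  moreover have "(c *\<^sub>R x, c *\<^sub>R y) \<in> C" "(c *\<^sub>R x, c *\<^sub>R z) \<in> D"
    using subspace_scale[OF assms(1) p(2), of c] subspace_scale[OF assms(2) p(3), of c] by auto
  ultimately show "c *\<^sub>R p \<in> op_sum C D" unfolding op_sum_def by blast
qed

lemma Domain_op_sum: "Domain (op_sum C D) = Domain C \<inter> Domain D"
  by (auto simp: op_sum_def)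

lemma subspace_Domain: "subspace G \<Longrightarrow> subspace (Domain G)"
  by (simp add: Domain_fst linear_fst linear_subspace_image)

lemma c0_semigroup_tendsto_compose:
  fixes T :: "real \<Rightarrow> 'a::banach \<Rightarrow>\<^sub>L 'a"
  assumes T: "c0_semigroup T" and p: "(p \<longlongrightarrow> z) (at_right 0)"
  shows "((\<lambda>\<tau>. T \<tau> (p \<tau>)) \<longlongrightarrow> z) (at_right 0)"
proof -
  obtain K where K: "\<And>s. 0 \<le> s \<Longrightarrow> s \<le> 1 \<Longrightarrow> norm (T s) \<le> K"
    using c0_semigroup_bounded[OF T, where R = 1] by metis
  have "((\<lambda>\<tau>. T \<tau> (p \<tau> - z)) \<longlongrightarrow> 0) (at_right 0)"
  proof (rule Lim_null_comparison)
    show "\<forall>\<^sub>F \<tau> in at_right 0. norm (T \<tau> (p \<tau> - z)) \<le> K * norm (p \<tau> - z)"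
    proof (rule eventually_at_right_0_I)
      fix \<tau> :: real assume "0 < \<tau>" "\<tau> < 1"
      then have "norm (T \<tau>) * norm (p \<tau> - z) \<le> K * norm (p \<tau> - z)"
        by (intro mult_right_mono K) auto
      with norm_blinfun[of "T \<tau>" "p \<tau> - z"] show "norm (T \<tau> (p \<tau> - z)) \<le> K * norm (p \<tau> - z)"
        by simp
    qed simp
    show "((\<lambda>\<tau>. K * norm (p \<tau> - z)) \<longlongrightarrow> 0) (at_right 0)"
      using p by (intro tendsto_mult_right_zero tendsto_norm_zero LIM_zero)
  qed
  from tendsto_add[OF this c0_semigroup_tendsto[OF T, of z]] show ?thesis
    by (simp add: blinfun.diff_right)
qed

text \<open>The quotient of the product is that of \<open>S\<close> plus \<open>S \<tau>\<close>
  applied to that of \<open>T\<close>; local boundedness of \<open>S\<close> lets the latter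
  converge.\<close>

lemma product_consistent:
  fixes S T :: "real \<Rightarrow> 'a::banach \<Rightarrow>\<^sub>L 'a"
  assumes S: "c0_semigroup S" and xy: "(x, y) \<in> strong_deriv0 S" and xz: "(x, z) \<in> strong_deriv0 T"
  shows "((\<lambda>\<tau>. ((S \<tau> o\<^sub>L T \<tau>) x - x) /\<^sub>R \<tau>) \<longlongrightarrow> y + z) (at_right 0)"
proof -
  have "((\<lambda>\<tau>. (S \<tau> x - x) /\<^sub>R \<tau> + S \<tau> ((T \<tau> x - x) /\<^sub>R \<tau>)) \<longlongrightarrow> y + z) (at_right 0)"
    using xy xz
    by (intro tendsto_add c0_semigroup_tendsto_compose[OF S]) (auto simp: strong_deriv0_def)
  then show ?thesis by (simp add: blinfun.bilinear_simps algebra_simps)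
qed

lemma adjoint_op_apply [simp]: "blinfun_apply (adjoint_op A) \<phi> = \<phi> o\<^sub>L A"
  by (simp add: adjoint_op.rep_eq)

text \<open>Taking adjoints reverses the order, so the quotient of \<open>S\<close> is followed by
  the adjoint of \<open>T \<tau>\<close>. The adjoint semigroup need not be strongly continuous, so
  continuity at \<open>\<psi>\<close> has to be assumed; condition (iv) supplies it.\<close>

lemma adjoint_product_consistent:
  fixes S T :: "real \<Rightarrow> 'a::banach \<Rightarrow>\<^sub>L 'a"
  assumes T: "c0_semigroup T"
    and S': "(\<phi>, \<psi>) \<in> strong_deriv0 (\<lambda>s. adjoint_op (S s))"
    and T': "(\<phi>, \<theta>) \<in> strong_deriv0 (\<lambda>s. adjoint_op (T s))"
    and cont: "((\<lambda>s. adjoint_op (T s) \<psi>) \<longlongrightarrow> \<psi>) (at_right 0)"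
  shows "((\<lambda>\<tau>. ((\<phi> o\<^sub>L (S \<tau> o\<^sub>L T \<tau>)) - \<phi>) /\<^sub>R \<tau>) \<longlongrightarrow> \<psi> + \<theta>) (at_right 0)"
proof -
  obtain K where K: "\<And>s. 0 \<le> s \<Longrightarrow> s \<le> 1 \<Longrightarrow> norm (T s) \<le> K"
    using c0_semigroup_bounded[OF T, where R = 1] by metis
  define p where "p \<tau> = ((\<phi> o\<^sub>L S \<tau>) - \<phi>) /\<^sub>R \<tau>" for \<tau>
  have p: "(p \<longlongrightarrow> \<psi>) (at_right 0)" using S' by (simp add: strong_deriv0_def p_def[abs_def])
  have "((\<lambda>\<tau>. (p \<tau> - \<psi>) o\<^sub>L T \<tau>) \<longlongrightarrow> 0) (at_right 0)"
  proof (rule Lim_null_comparison)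
    show "\<forall>\<^sub>F \<tau> in at_right 0. norm ((p \<tau> - \<psi>) o\<^sub>L T \<tau>) \<le> norm (p \<tau> - \<psi>) * K"
    proof (rule eventually_at_right_0_I)
      fix \<tau> :: real assume "0 < \<tau>" "\<tau> < 1"
      then have "norm (p \<tau> - \<psi>) * norm (T \<tau>) \<le> norm (p \<tau> - \<psi>) * K"
        by (intro mult_left_mono K) auto
      with norm_blinfun_compose[of "p \<tau> - \<psi>" "T \<tau>"]
      show "norm ((p \<tau> - \<psi>) o\<^sub>L T \<tau>) \<le> norm (p \<tau> - \<psi>) * K" by linarith
    qed simp
    show "((\<lambda>\<tau>. norm (p \<tau> - \<psi>) * K) \<longlongrightarrow> 0) (at_right 0)"
      using p by (intro tendsto_mult_left_zero tendsto_norm_zero LIM_zero)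
  qed
  moreover have "((\<lambda>\<tau>. ((\<phi> o\<^sub>L T \<tau>) - \<phi>) /\<^sub>R \<tau>) \<longlongrightarrow> \<theta>) (at_right 0)"
    using T' by (simp add: strong_deriv0_def)
  moreover have "((\<lambda>\<tau>. \<psi> o\<^sub>L T \<tau>) \<longlongrightarrow> \<psi>) (at_right 0)" using cont by simp
  ultimately have "((\<lambda>\<tau>. ((p \<tau> - \<psi>) o\<^sub>L T \<tau>) + (\<psi> o\<^sub>L T \<tau>) + ((\<phi> o\<^sub>L T \<tau>) - \<phi>) /\<^sub>R \<tau>) \<longlongrightarrow> 0 + \<psi> + \<theta>) (at_right 0)"
    by (intro tendsto_add)
  moreover have "((p \<tau> - \<psi>) o\<^sub>L T \<tau>) + (\<psi> o\<^sub>L T \<tau>) + ((\<phi> o\<^sub>L T \<tau>) - \<phi>) /\<^sub>R \<tau> = ((\<phi> o\<^sub>L (S \<tau> o\<^sub>L T \<tau>)) - \<phi>) /\<^sub>R \<tau>" for \<tau>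
    by (rule blinfun_eqI) (simp add: p_def blinfun.bilinear_simps algebra_simps)
  ultimately show ?thesis by simp
qed

text \<open>Evaluation at \<open>z\<close> is weak-* continuous, so the functionals vanishing at
  \<open>z\<close> form a weak-* closed set; containing \<open>B\<close>, it is the whole
  dual.\<close>

lemma weak_star_dense_separating:
  fixes B :: "('a::real_normed_vector \<Rightarrow>\<^sub>L real) set"
  assumes "weak_star_topology closure_of B = UNIV" "\<And>\<phi>. \<phi> \<in> B \<Longrightarrow> blinfun_apply \<phi> z = 0"
  shows "z = 0"
proof -
  have "closedin weak_star_topology {\<phi> \<in> topspace weak_star_topology. blinfun_apply \<phi> z \<in> {0::real}}"
    by (rule closedin_continuous_map_preimage[OF strong_operator_topology_continuous_evaluation]) simp
  then have "weak_star_topology closure_of B \<subseteq> {\<phi>. blinfun_apply \<phi> z = 0}"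
    using assms(2) by (intro closure_of_minimal) (auto simp: strong_operator_topology_topspace)
  with assms(1) have "blinfun_apply \<phi> z = blinfun_apply \<phi> 0" for \<phi> :: "'a \<Rightarrow>\<^sub>L real" by auto
  then show ?thesis by (rule eq_if_functionals_eq)
qed

theorem corollary5p1:
  fixes C D :: "('a::banach \<times> 'a) set"
    and S T :: "real \<Rightarrow> 'a \<Rightarrow>\<^sub>L 'a"
    and B :: "('a \<Rightarrow>\<^sub>L real) set"
    and t :: real
  assumes "t > 0"
    and "generates C S" and "generates D T"
    and "B \<subseteq> Domain (strong_deriv0 (\<lambda>s. adjoint_op (S s))) \<inter>
             Domain (strong_deriv0 (\<lambda>s. adjoint_op (T s)))"
    and "closure (Domain C \<inter> Domain D) = UNIV"
    and "weak_star_topology closure_of B = UNIV"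
    and "\<exists>a::real. \<exists>M\<ge>1. \<forall>n\<ge>1. \<forall>m\<ge>1. \<forall>s>0.
           onorm (blinfun_apply (S (s / real n) o\<^sub>L T (s / real n)) ^^ m)
             \<le> M * exp (a * s * (real m / real n))"
    and "\<forall>x \<in> strong_deriv0 (\<lambda>s. adjoint_op (S s)) `` B.
           continuous (at 0 within {0..}) (\<lambda>s. adjoint_op (T s) x)"
  shows "(closable (op_sum C D) \<and> (\<exists>U. generates (closure (op_sum C D)) U)
            \<longleftrightarrow> (\<exists>A. approximation_subspace t S T C D A)) \<and>
         ((\<exists>A. approximation_subspace t S T C D A) \<longrightarrow>
            (\<forall>U. generates (closure (op_sum C D)) U \<longrightarrow>
              (\<forall>s\<ge>0. \<forall>f.
                (\<lambda>n. (blinfun_apply (S (s / real n) o\<^sub>L T (s / real n)) ^^ n) f)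
                  \<longlonglongrightarrow> U s f)))"
proof -
  have S: "c0_semigroup S" "C = strong_deriv0 S" and T: "c0_semigroup T" "D = strong_deriv0 T"
    using assms(2,3) by (auto simp: generates_def)
  define V where "V \<tau> = S \<tau> o\<^sub>L T \<tau>" for \<tau>
  define G where "G = op_sum C D"
  obtain a M where M: "M \<ge> 1" and stable: "\<And>n m s. n \<ge> 1 \<Longrightarrow> m \<ge> 1 \<Longrightarrow> s > 0 \<Longrightarrow>
      onorm (blinfun_apply (V (s / real n)) ^^ m) \<le> M * exp (a * s * (real m / real n))"
    using assms(7) unfolding V_def by blast
  interpret chernoff_family V G M "max a 0"
  proof
    fix \<tau> m x assume \<tau>: "\<tau> > (0::real)"
    have "bounded_linear (blinfun_apply (V \<tau>) ^^ m)"
      by (induction m) (simp_all add: bounded_linear_ident bounded_linear_compose blinfun.bounded_linear_right comp_def id_def)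
    then have "norm ((blinfun_apply (V \<tau>) ^^ m) x) \<le> onorm (blinfun_apply (V \<tau>) ^^ m) * norm x"
      by (rule onorm)
    also have "onorm (blinfun_apply (V \<tau>) ^^ m) \<le> M * exp (max a 0 * (real m * \<tau>))"
    \<comment> \<open>Condition (iii) concerns positive \<open>m\<close>; the power 0 is the
      identity, bounded by \<open>M \<ge> 1\<close>. Otherwise its instance \<open>n = 1\<close>,
      \<open>s = \<tau>\<close> covers every step size.\<close>
    proof (cases "m = 0")
      case True
      then show ?thesis using M onorm_id_le[where 'a = 'a] by (simp add: id_def)
    next
      case False
      then have "onorm (blinfun_apply (V \<tau>) ^^ m) \<le> M * exp (a * (real m * \<tau>))"
        using stable[of 1 m \<tau>] \<tau> by (simp add: mult_ac)
      also have "\<dots> \<le> M * exp (max a 0 * (real m * \<tau>))"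
        using M \<tau> by (intro mult_left_mono) (auto intro!: mult_right_mono)
      finally show ?thesis .
    qed
    finally show "norm ((blinfun_apply (V \<tau>) ^^ m) x) \<le> M * exp (max a 0 * (real m * \<tau>)) * norm x"
      by (simp add: mult_right_mono)
  next
    fix x y assume "(x, y) \<in> G"
    then show "((\<lambda>\<tau>. (V \<tau> x - x) /\<^sub>R \<tau>) \<longlongrightarrow> y) (at_right 0)"
      using product_consistent[OF S(1)] by (auto simp: G_def op_sum_def S(2) T(2) V_def)
  next
    show "subspace G" by (simp add: G_def S(2) T(2) subspace_op_sum subspace_strong_deriv0)
    show "closure (Domain G) = UNIV" using assms(5) by (simp add: G_def Domain_op_sum)
  qed (use M in auto)
  \<comment> \<open>Rounding \<open>n * s\<close> and taking steps of length \<open>t / n\<close>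
    amounts to time \<open>t * s\<close>. For \<open>n = 0\<close> the conventions for division by
    zero make both exponents 0.\<close>
  have W_floor: "(blinfun_apply (S (t / real n) o\<^sub>L T (t / real n)) ^^ nat \<lfloor>real n * s\<rfloor>) f
      = W (t / real n) (t * s) f" for n s f
    using assms(1) by (cases "n = 0") (simp_all add: W_def V_def mult.commute)
  have adjoint: "\<exists>\<psi>. ((\<lambda>\<tau>. ((\<phi> o\<^sub>L V \<tau>) - \<phi>) /\<^sub>R \<tau>) \<longlongrightarrow> \<psi>) (at_right 0)" if \<phi>: "\<phi> \<in> B" for \<phi>
  proof -
    obtain \<psi> \<theta> where S': "(\<phi>, \<psi>) \<in> strong_deriv0 (\<lambda>s. adjoint_op (S s))"
      and T': "(\<phi>, \<theta>) \<in> strong_deriv0 (\<lambda>s. adjoint_op (T s))"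
      using assms(4) \<phi> by blast
    have "continuous (at 0 within {0..}) (\<lambda>s. adjoint_op (T s) \<psi>)" using assms(8) S' \<phi> by blast
    then have "((\<lambda>s. adjoint_op (T s) \<psi>) \<longlongrightarrow> adjoint_op (T 0) \<psi>) (at 0 within {0..})"
      by (simp add: continuous_within)
    moreover have "adjoint_op (T 0) \<psi> = \<psi>"
      by (simp add: c0_semigroup_zero[OF T(1)] blinfun_eqI)
    ultimately have "((\<lambda>s. adjoint_op (T s) \<psi>) \<longlongrightarrow> \<psi>) (at_right 0)"
      by (auto elim!: tendsto_within_subset simp: less_imp_le)
    from adjoint_product_consistent[OF T(1) S' T' this] show ?thesis unfolding V_def by blast
  qed
  have "\<exists>U. generates (closure G) U" if A: "approximation_subspace t S T C D A" for A
  proof (rule closure_generates)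
    show closure_A: "closure A = UNIV" using A by (simp add: approximation_subspace_def)
    fix f assume f: "f \<in> A"
    show "\<exists>u w. classical_solution (closure G) u w \<and> u 0 = f"
    proof (rule weak_limits_solve[OF assms(1) _ closure_A _ adjoint _ f])
      show "A \<subseteq> Domain G" using A by (simp add: approximation_subspace_def G_def Domain_op_sum)
      show "z = 0" if "\<And>\<phi>. \<phi> \<in> B \<Longrightarrow> blinfun_apply \<phi> z = 0" for z
        using assms(6) that by (rule weak_star_dense_separating)
      fix g s assume "g \<in> A" and s: "(0::real) \<le> s"
      \<comment> \<open>Times of \<open>W\<close> are those of the approximation condition
        multiplied by \<open>t\<close>.\<close>
      then have "approximable t S T C D g (s / t)"
        using A assms(1) by (simp add: approximation_subspace_def)
      then show "\<exists>p h. (\<forall>n. (p n, h n) \<in> G) \<and>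
          (\<lambda>n. norm (W (t / real n) s g - p n)) \<longlonglongrightarrow> 0 \<and> weakly_subseq_compact p \<and> weakly_subseq_compact h"
        using assms(1) unfolding approximable_def W_floor G_def by simp
    qed
  qed
  moreover have "approximation_subspace t S T C D (Domain C \<inter> Domain D)"
    if U: "generates (closure G) U" for U
    unfolding approximation_subspace_def
  proof (intro conjI ballI allI impI)
    show "subspace (Domain C \<inter> Domain D)"
      using subspace_Domain[OF subspace_G] by (simp add: G_def Domain_op_sum)
    show "closure (Domain C \<inter> Domain D) = UNIV" by (rule assms(5))
    fix f and s :: real assume f: "f \<in> Domain C \<inter> Domain D" and s: "s \<ge> 0"
    then have "f \<in> Domain G" by (simp add: G_def Domain_op_sum)
    then obtain y where "(f, y) \<in> closure G" using closure_subset by blast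
    then have "(U (t * s) f, U (t * s) y) \<in> closure G"
      using generates_invariant[OF U] s assms(1) by simp
    then obtain p where p: "\<And>n. p n \<in> G" "p \<longlonglongrightarrow> (U (t * s) f, U (t * s) y)"
      unfolding closure_sequential by blast
    have fst: "(\<lambda>n. fst (p n)) \<longlonglongrightarrow> U (t * s) f" and snd: "(\<lambda>n. snd (p n)) \<longlonglongrightarrow> U (t * s) y"
      using tendsto_fst[OF p(2)] tendsto_snd[OF p(2)] by auto
    have "filterlim (\<lambda>n. t / real n) (at_right 0) sequentially"
      using strict_mono_filterlim_at_right_0[OF assms(1) strict_mono_id] by simp
    from filterlim_compose[OF Chernoff_product_formula[OF U] this, of "t * s" f]
    have "(\<lambda>n. W (t / real n) (t * s) f) \<longlonglongrightarrow> U (t * s) f" using s assms(1) by simp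
    from tendsto_norm_zero[OF LIM_zero[OF tendsto_diff[OF this fst]]]
    have "(\<lambda>n. norm (W (t / real n) (t * s) f - fst (p n))) \<longlonglongrightarrow> 0" by simp
    then show "approximable t S T C D f s"
      unfolding approximable_def W_floor
      using p(1) tendsto_imp_weakly_subseq_compact[OF fst] tendsto_imp_weakly_subseq_compact[OF snd]
      by (intro exI[of _ "\<lambda>n. fst (p n)"] exI[of _ "\<lambda>n. snd (p n)"]) (auto simp: G_def)
  qed auto
  moreover have "(\<lambda>n. (blinfun_apply (V (s / real n)) ^^ n) f) \<longlonglongrightarrow> U s f"
    if U: "generates (closure G) U" and s: "s \<ge> 0" for U s f
  \<comment> \<open>For \<open>s = 0\<close> the step lengths do not approach 0 from the right; all
    factors are then the identity.\<close>
  proof (cases "s = 0")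
    case True
    have "V 0 = id_blinfun"
      by (rule blinfun_eqI) (simp add: V_def c0_semigroup_zero[OF S(1)] c0_semigroup_zero[OF T(1)])
    then have "(blinfun_apply (V 0) ^^ n) f = f" for n by (induction n) auto
    then show ?thesis using True U by (simp add: generates_def c0_semigroup_zero)
  next
    case False
    with s have "s > 0" by simp
    then have "filterlim (\<lambda>n. s / real n) (at_right 0) sequentially"
      using strict_mono_filterlim_at_right_0[OF _ strict_mono_id] by simp
    from filterlim_compose[OF Chernoff_product_formula[OF U s] this]
    have "(\<lambda>n. W (s / real n) s f) \<longlonglongrightarrow> U s f" .
    \<comment> \<open>Here \<open>s\<close> is an exact multiple of the step length, so rounding has
      no effect; for \<open>n = 0\<close> both exponents are 0.\<close>
    moreover have "W (s / real n) s f = (blinfun_apply (V (s / real n)) ^^ n) f" for n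
      using \<open>s > 0\<close> by (cases "n = 0") (simp_all add: W_def)
    ultimately show ?thesis by simp
  qed
  ultimately show ?thesis using closable_G unfolding G_def V_def by blast
qed

end
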